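(* Let $X$ be a non-vanishing volume-preserving vector field on a connected oriented three-manifold $M$. If $X$ admits a positive rational half-twisting region and a negative rational half-twisting region, then $X$ is not Reeb-like.
   Context: A vector field $X$ is Reeb-like if there is a contact form $\alpha$ (a one-form with $\alpha\wedge d\alpha\neq0$ everywhere) with $\alpha(X)>0$ and $\iota_Xd\alpha=0$. An integrable region of $X$ is a domain $U\subset M$ diffeomorphic to $T^2\times I$, $I$ an interval, such that $X$ is tangent to the torus fibers. Let $\mu$ be a volume form preserved by $X$, let $(x,y,r)$ be coordinates on $U\cong T^2\times I$ with $dx\wedge dy\wedge dr$ positive, and write $\mu=dr\wedge\sigma_r$ with $\sigma_r$ a family of area forms on $T^2$; with $X_r=X|_{T^2\times\{r\}}$, the one-forms $\iota_{X_r}\sigma_r$ on $T^2$ are closed and non-vanishing, and the slope function is $$k_U:I\to PH^1(T^2;\mathbb R)=(H^1(T^2;\mathbb R)\setminus\{0\})/\mathbb R^+\cong S^1,\qquad k_U(r)=[\iota_{X_r}\sigma_r],$$ where $H^1(T^2;\mathbb R)\cong\mathbb R^2$ via the basis $[dx],[dy]$. (When $X$ is a positive multiple of $f_1(r)\partial_x+f_2(r)\partial_y$, up to the antipodal map this is $(f_2,-f_1)/|(f_1,f_2)|$.) For $p,q\in S^1$, $(p,q)$ denotes the open arc from $p$ to $q$ in the clockwise direction. $X$ admits a positive (resp. negative) half-twisting region if there is an integrable region $U\cong T^2\times I$ and an interval $[a,b]\subset I$ such that $k_U(b)=-k_U(a)$ and $k_U(r)\in(k_U(a),k_U(b))$ (resp.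 $k_U(r)\in(k_U(b),k_U(a))$) for all $r\in(a,b)$. It is rational if $k_U(a),k_U(b)$ are rational points of $S^1$, i.e. positive multiples of rational vectors. *)

theory Defs
  imports "HOL-Analysis.Analysis"
begin

section \<open>Smooth maps between Euclidean spaces\<close>

text \<open>Both notions below are meant for open sets \<open>S\<close>.\<close>

primrec Ck_on ::
  "nat \<Rightarrow> 'a::real_normed_vector set \<Rightarrow> ('a \<Rightarrow> 'b::real_normed_vector) \<Rightarrow> bool" where
  "Ck_on 0 S f \<longleftrightarrow> continuous_on S f"
| "Ck_on (Suc k) S f \<longleftrightarrow>
     (\<forall>x\<in>S. f differentiable (at x)) \<and>
     (\<forall>v. Ck_on k S (\<lambda>x. frechet_derivative f (at x) v))"

definition smooth_on ::
  "'a::real_normed_vector set \<Rightarrow> ('a \<Rightarrow> 'b::real_normed_vector) \<Rightarrow> bool" where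
  "smooth_on S f \<longleftrightarrow> (\<forall>k. Ck_on k S f)"

abbreviation D :: "('a::real_normed_vector \<Rightarrow> 'b::real_normed_vector) \<Rightarrow> 'a \<Rightarrow> 'a \<Rightarrow> 'b" where
  "D f x v \<equiv> frechet_derivative f (at x) v"


section \<open>Oriented three-manifolds\<close>

type_synonym 'a chart = "'a set \<times> ('a \<Rightarrow> real^3)"

abbreviation chart_image :: "'a chart \<Rightarrow> (real^3) set" where
  "chart_image c \<equiv> snd c ` fst c"

abbreviation overlap :: "'a chart \<Rightarrow> 'a chart \<Rightarrow> (real^3) set" where
  "overlap c d \<equiv> snd c ` (fst c \<inter> fst d)"

definition transition :: "'a chart \<Rightarrow> 'a chart \<Rightarrow> real^3 \<Rightarrow> real^3" where
  "transition c d = snd d \<circ> inv_into (fst c) (snd c)"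

definition chart_on :: "'a topology \<Rightarrow> 'a chart \<Rightarrow> bool" where
  "chart_on M c \<longleftrightarrow> openin M (fst c) \<and> open (chart_image c) \<and>
     homeomorphic_map (subtopology M (fst c)) (top_of_set (chart_image c)) (snd c)"

text \<open>The atlas \<open>A\<close> carries both the smooth structure and the orientation: every chart is
  positively oriented. It need not be maximal.\<close>

definition oriented_atlas :: "'a topology \<Rightarrow> 'a chart set \<Rightarrow> bool" where
  "oriented_atlas M A \<longleftrightarrow>
     (\<forall>c\<in>A. chart_on M c) \<and> (\<Union>c\<in>A. fst c) = topspace M \<and>
     (\<forall>c\<in>A. \<forall>d\<in>A. smooth_on (overlap c d) (transition c d) \<and>
        (\<forall>x\<in>overlap c d. det (matrix (D (transition c d) x)) > 0))"

definition oriented_3manifold :: "'a topology \<Rightarrow> 'a chart set \<Rightarrow> bool" where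
  "oriented_3manifold M A \<longleftrightarrow>
     Hausdorff_space M \<and> second_countable M \<and> oriented_atlas M A"


section \<open>Vector fields and differential forms\<close>

text \<open>A tensor field is the family of its coordinate representations, one for each chart of the
  atlas, related by the usual transformation law. In \<open>X c x\<close> the point \<open>x\<close> is a coordinate
  point, i.e. an element of \<open>chart_image c\<close>.\<close>

type_synonym 'a vfield = "'a chart \<Rightarrow> real^3 \<Rightarrow> real^3"
type_synonym 'a form1 = "'a chart \<Rightarrow> real^3 \<Rightarrow> real^3 \<Rightarrow> real"
type_synonym 'a form2 = "'a chart \<Rightarrow> real^3 \<Rightarrow> real^3 \<Rightarrow> real^3 \<Rightarrow> real"
type_synonym 'a form3 = "'a chart \<Rightarrow> real^3 \<Rightarrow> real^3 \<Rightarrow> real^3 \<Rightarrow> real^3 \<Rightarrow> real"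

definition vector_field :: "'a chart set \<Rightarrow> 'a vfield \<Rightarrow> bool" where
  "vector_field A X \<longleftrightarrow>
     (\<forall>c\<in>A. smooth_on (chart_image c) (X c)) \<and>
     (\<forall>c\<in>A. \<forall>d\<in>A. \<forall>x\<in>overlap c d. X d (transition c d x) = D (transition c d) x (X c x))"

definition nonvanishing :: "'a chart set \<Rightarrow> 'a vfield \<Rightarrow> bool" where
  "nonvanishing A X \<longleftrightarrow> (\<forall>c\<in>A. \<forall>x\<in>chart_image c. X c x \<noteq> 0)"

definition one_form :: "'a chart set \<Rightarrow> 'a form1 \<Rightarrow> bool" where
  "one_form A \<alpha> \<longleftrightarrow>
     (\<forall>c\<in>A. (\<forall>x\<in>chart_image c. linear (\<alpha> c x)) \<and>
            (\<forall>v. smooth_on (chart_image c) (\<lambda>x. \<alpha> c x v))) \<and>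
     (\<forall>c\<in>A. \<forall>d\<in>A. \<forall>x\<in>overlap c d. \<forall>v.
        \<alpha> c x v = \<alpha> d (transition c d x) (D (transition c d) x v))"

definition alternating3 :: "(real^3 \<Rightarrow> real^3 \<Rightarrow> real^3 \<Rightarrow> real) \<Rightarrow> bool" where
  "alternating3 \<omega> \<longleftrightarrow>
     (\<forall>u v. linear (\<lambda>w. \<omega> w u v) \<and> linear (\<lambda>w. \<omega> u w v) \<and> linear (\<lambda>w. \<omega> u v w)) \<and>
     (\<forall>u v. \<omega> u u v = 0 \<and> \<omega> u v u = 0 \<and> \<omega> u v v = 0)"

definition three_form :: "'a chart set \<Rightarrow> 'a form3 \<Rightarrow> bool" where
  "three_form A \<omega> \<longleftrightarrow>
     (\<forall>c\<in>A. (\<forall>x\<in>chart_image c. alternating3 (\<omega> c x)) \<and>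
            (\<forall>u v w. smooth_on (chart_image c) (\<lambda>x. \<omega> c x u v w))) \<and>
     (\<forall>c\<in>A. \<forall>d\<in>A. \<forall>x\<in>overlap c d. \<forall>u v w.
        \<omega> c x u v w = \<omega> d (transition c d x)
          (D (transition c d) x u) (D (transition c d) x v) (D (transition c d) x w))"

definition volume_form :: "'a chart set \<Rightarrow> 'a form3 \<Rightarrow> bool" where
  "volume_form A \<mu> \<longleftrightarrow> three_form A \<mu> \<and>
     (\<forall>c\<in>A. \<forall>x\<in>chart_image c. \<mu> c x \<noteq> (\<lambda>u v w. 0))"

definition ext_deriv :: "'a form1 \<Rightarrow> 'a form2" where
  "ext_deriv \<alpha> c x u v = D (\<lambda>y. \<alpha> c y v) x u - D (\<lambda>y. \<alpha> c y u) x v"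

definition wedge :: "'a form1 \<Rightarrow> 'a form2 \<Rightarrow> 'a form3" where
  "wedge \<alpha> \<eta> c x u v w =
     \<alpha> c x u * \<eta> c x v w + \<alpha> c x v * \<eta> c x w u + \<alpha> c x w * \<eta> c x u v"

definition Lie_deriv :: "'a vfield \<Rightarrow> 'a form3 \<Rightarrow> 'a form3" where
  "Lie_deriv X \<omega> c x u v w =
     D (\<lambda>y. \<omega> c y u v w) x (X c x) +
     \<omega> c x (D (X c) x u) v w + \<omega> c x u (D (X c) x v) w + \<omega> c x u v (D (X c) x w)"

definition preserves :: "'a chart set \<Rightarrow> 'a vfield \<Rightarrow> 'a form3 \<Rightarrow> bool" where
  "preserves A X \<mu> \<longleftrightarrow> (\<forall>c\<in>A. \<forall>x\<in>chart_image c. Lie_deriv X \<mu> c x = (\<lambda>u v w. 0))"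

definition volume_preserving :: "'a chart set \<Rightarrow> 'a vfield \<Rightarrow> bool" where
  "volume_preserving A X \<longleftrightarrow> (\<exists>\<mu>. volume_form A \<mu> \<and> preserves A X \<mu>)"

definition contact_form :: "'a chart set \<Rightarrow> 'a form1 \<Rightarrow> bool" where
  "contact_form A \<alpha> \<longleftrightarrow> one_form A \<alpha> \<and>
     (\<forall>c\<in>A. \<forall>x\<in>chart_image c. wedge \<alpha> (ext_deriv \<alpha>) c x \<noteq> (\<lambda>u v w. 0))"

definition reeb_like :: "'a chart set \<Rightarrow> 'a vfield \<Rightarrow> bool" where
  "reeb_like A X \<longleftrightarrow> (\<exists>\<alpha>. contact_form A \<alpha> \<and>
     (\<forall>c\<in>A. \<forall>x\<in>chart_image c.
        \<alpha> c x (X c x) > 0 \<and> (\<forall>v. ext_deriv \<alpha> c x (X c x) v = 0)))"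


section \<open>Integrable regions\<close>

text \<open>We take \<open>T\<^sup>2 = \<real>\<^sup>2/\<int>\<^sup>2\<close>, and describe a diffeomorphism from \<open>T\<^sup>2 \<times> I\<close> onto a region \<open>U\<close> of
  the manifold by its lift \<open>F\<close> to the universal cover \<open>\<real>\<^sup>2 \<times> I\<close> (so \<open>U = F ` slab I\<close>). The
  coordinates \<open>x, y, r\<close> are the components 1, 2, 3. If \<open>I\<close> contains an end point, smoothness
  means that \<open>F\<close> has a smooth extension to an open set \<open>V\<close>; only its behaviour on \<open>slab I\<close>
  matters.\<close>

definition slab :: "real set \<Rightarrow> (real^3) set" where
  "slab I = {q. q $ 3 \<in> I}"

definition smooth_into ::
  "'a topology \<Rightarrow> 'a chart set \<Rightarrow> (real^3) set \<Rightarrow> (real^3 \<Rightarrow> 'a) \<Rightarrow> bool" where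
  "smooth_into M A V F \<longleftrightarrow> open V \<and> continuous_map (top_of_set V) M F \<and>
     (\<forall>c\<in>A. smooth_on {q\<in>V. F q \<in> fst c} (snd c \<circ> F))"

definition oriented_torus_coords ::
  "'a topology \<Rightarrow> 'a chart set \<Rightarrow> real set \<Rightarrow> (real^3 \<Rightarrow> 'a) \<Rightarrow> bool" where
  "oriented_torus_coords M A I F \<longleftrightarrow> is_interval I \<and>
     (\<exists>V. slab I \<subseteq> V \<and> smooth_into M A V F) \<and>
     (\<forall>p\<in>slab I. \<forall>q\<in>slab I.
        F p = F q \<longleftrightarrow> p $ 1 - q $ 1 \<in> \<int> \<and> p $ 2 - q $ 2 \<in> \<int> \<and> p $ 3 = q $ 3) \<and>
     open_map (top_of_set (slab I)) (subtopology M (F ` slab I)) F \<and>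
     (\<forall>q\<in>slab I. \<forall>c\<in>A. F q \<in> fst c \<longrightarrow> det (matrix (D (snd c \<circ> F) q)) > 0)"

text \<open>Components of a vector field and of a three-form in the coordinates \<open>x, y, r\<close>. By the
  transformation laws the defining conditions agree for all charts around \<open>F q\<close>.\<close>

definition pull_vec :: "'a chart set \<Rightarrow> (real^3 \<Rightarrow> 'a) \<Rightarrow> 'a vfield \<Rightarrow> real^3 \<Rightarrow> real^3" where
  "pull_vec A F X q =
     (THE v. \<forall>c\<in>A. F q \<in> fst c \<longrightarrow> D (snd c \<circ> F) q v = X c (snd c (F q)))"

definition pull_form3 :: "'a chart set \<Rightarrow> (real^3 \<Rightarrow> 'a) \<Rightarrow> 'a form3 \<Rightarrow>
    real^3 \<Rightarrow> real^3 \<Rightarrow> real^3 \<Rightarrow> real^3 \<Rightarrow> real" where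
  "pull_form3 A F \<omega> q u v w =
     (THE t. \<forall>c\<in>A. F q \<in> fst c \<longrightarrow>
        t = \<omega> c (snd c (F q)) (D (snd c \<circ> F) q u) (D (snd c \<circ> F) q v) (D (snd c \<circ> F) q w))"

definition integrable_region ::
  "'a topology \<Rightarrow> 'a chart set \<Rightarrow> 'a vfield \<Rightarrow> real set \<Rightarrow> (real^3 \<Rightarrow> 'a) \<Rightarrow> bool" where
  "integrable_region M A X I F \<longleftrightarrow> oriented_torus_coords M A I F \<and>
     (\<forall>q\<in>slab I. pull_vec A F X q $ 3 = 0)"


section \<open>The slope function\<close>

abbreviation torus_pt :: "real^2 \<Rightarrow> real \<Rightarrow> real^3" where
  "torus_pt z r \<equiv> vector [z $ 1, z $ 2, r]"

abbreviation torus_vec :: "real^2 \<Rightarrow> real^3" where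
  "torus_vec v \<equiv> vector [v $ 1, v $ 2, 0]"

text \<open>If \<open>\<mu> = dr \<and> \<sigma>\<^sub>r\<close> with \<open>\<sigma>\<^sub>r\<close> a two-form on the torus, then \<open>\<sigma>\<^sub>r\<close> is the restriction to the
  torus of the contraction of \<open>\<mu>\<close> with \<open>\<partial>\<^sub>r\<close>.\<close>

definition area_form :: "'a chart set \<Rightarrow> (real^3 \<Rightarrow> 'a) \<Rightarrow> 'a form3 \<Rightarrow> real \<Rightarrow>
    real^2 \<Rightarrow> real^2 \<Rightarrow> real^2 \<Rightarrow> real" where
  "area_form A F \<mu> r z u v =
     pull_form3 A F \<mu> (torus_pt z r) (axis 3 1) (torus_vec u) (torus_vec v)"

definition torus_field :: "'a chart set \<Rightarrow> (real^3 \<Rightarrow> 'a) \<Rightarrow> 'a vfield \<Rightarrow> real \<Rightarrow>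
    real^2 \<Rightarrow> real^2" where
  "torus_field A F X r z =
     (let v = pull_vec A F X (torus_pt z r) in vector [v $ 1, v $ 2])"

definition slope_form :: "'a chart set \<Rightarrow> (real^3 \<Rightarrow> 'a) \<Rightarrow> 'a vfield \<Rightarrow> 'a form3 \<Rightarrow> real \<Rightarrow>
    real^2 \<Rightarrow> real^2 \<Rightarrow> real" where
  "slope_form A F X \<mu> r z v = area_form A F \<mu> r z (torus_field A F X r z) v"

definition torus_function :: "(real^2 \<Rightarrow> real) \<Rightarrow> bool" where
  "torus_function f \<longleftrightarrow> smooth_on UNIV f \<and>
     (\<forall>p q. p $ 1 - q $ 1 \<in> \<int> \<and> p $ 2 - q $ 2 \<in> \<int> \<longrightarrow> f p = f q)"

text \<open>The de Rham class of a closed one-form on the torus; \<open>Complex a b\<close> stands for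
  \<open>a [dx] + b [dy]\<close>.\<close>

definition torus_class :: "(real^2 \<Rightarrow> real^2 \<Rightarrow> real) \<Rightarrow> complex" where
  "torus_class \<beta> = (THE w. \<exists>f. torus_function f \<and>
     (\<forall>z v. \<beta> z v = Re w * v $ 1 + Im w * v $ 2 + D f z v))"

text \<open>The class modulo positive scalars, represented by the unit vector \<open>sgn w = w / cmod w\<close>.\<close>

definition slope :: "'a chart set \<Rightarrow> 'a vfield \<Rightarrow> 'a form3 \<Rightarrow> (real^3 \<Rightarrow> 'a) \<Rightarrow> real \<Rightarrow> complex" where
  "slope A X \<mu> F r = sgn (torus_class (slope_form A F X \<mu> r))"


section \<open>Half-twisting regions\<close>

text \<open>Points on the unit circle met when moving clockwise from \<open>p\<close> before \<open>q\<close> is reached.\<close>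

definition cw_arc :: "complex \<Rightarrow> complex \<Rightarrow> complex set" where
  "cw_arc p q = {p * cis (- t) | t. 0 < t \<and> (\<forall>s\<in>{0<..t}. p * cis (- s) \<noteq> q)}"

definition rational_point :: "complex \<Rightarrow> bool" where
  "rational_point p \<longleftrightarrow> cmod p = 1 \<and>
     (\<exists>t m n. t > 0 \<and> m \<in> \<rat> \<and> n \<in> \<rat> \<and> p = complex_of_real t * Complex m n)"

definition positive_half_twist :: "(real \<Rightarrow> complex) \<Rightarrow> real \<Rightarrow> real \<Rightarrow> bool" where
  "positive_half_twist k a b \<longleftrightarrow> k b = - k a \<and> (\<forall>r\<in>{a<..<b}. k r \<in> cw_arc (k a) (k b))"

definition negative_half_twist :: "(real \<Rightarrow> complex) \<Rightarrow> real \<Rightarrow> real \<Rightarrow> bool" where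
  "negative_half_twist k a b \<longleftrightarrow> k b = - k a \<and> (\<forall>r\<in>{a<..<b}. k r \<in> cw_arc (k b) (k a))"

definition admits_rational_half_twisting_region ::
  "((real \<Rightarrow> complex) \<Rightarrow> real \<Rightarrow> real \<Rightarrow> bool) \<Rightarrow>
   'a topology \<Rightarrow> 'a chart set \<Rightarrow> 'a vfield \<Rightarrow> bool" where
  "admits_rational_half_twisting_region twist M A X \<longleftrightarrow>
     (\<exists>\<mu> I F a b. volume_form A \<mu> \<and> preserves A X \<mu> \<and> integrable_region M A X I F \<and>
        a < b \<and> {a..b} \<subseteq> I \<and> twist (slope A X \<mu> F) a b \<and>
        rational_point (slope A X \<mu> F a) \<and> rational_point (slope A X \<mu> F b))"

end

theory Submission
  imports Defs
begin

text \<open>Suppose that \<open>X\<close> is Reeb-like with contact form \<open>\<alpha>\<close>. On an integrable region the restriction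
  \<open>\<alpha>\<^sub>r\<close> of \<open>\<alpha>\<close> to the torus at height \<open>r\<close> is closed, because \<open>X\<close> is tangent to the torus and spans the
  kernel of \<open>d\<alpha>\<close>. The form \<open>\<beta>\<^sub>r\<close> that defines the slope (the contraction of \<open>\<sigma>\<^sub>r\<close> with \<open>X\<close>) is closed,
  because \<open>X\<close> preserves \<open>\<mu>\<close>. Three facts relate the classes of these forms in the plane \<open>H\<^sup>1(T\<^sup>2)\<close>.

  \<^item> \<open>\<alpha>\<^sub>r \<and> \<beta>\<^sub>r\<close> is \<open>\<alpha>(X)\<close> times \<open>\<sigma>\<^sub>r\<close>. So \<open>[\<alpha>\<^sub>r] \<and> [\<beta>\<^sub>r]\<close> has the sign \<open>s\<close> of \<open>\<mu>\<close> for every \<open>r\<close>.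

  \<^item> The derivative of \<open>[\<alpha>\<^sub>r]\<close> in \<open>r\<close> is \<open>-[\<gamma>\<^sub>r]\<close>, where \<open>\<gamma>\<^sub>r\<close> is the closed form \<open>v \<mapsto> d\<alpha>(v, \<partial>\<^sub>r)\<close>
    on the torus. Both \<open>\<gamma>\<^sub>r\<close> and \<open>\<beta>\<^sub>r\<close> annihilate \<open>X\<close>, so \<open>\<gamma>\<^sub>r \<and> \<beta>\<^sub>r = 0\<close>. By the Riemann bilinear
    relation the wedge of the classes vanishes too, and \<open>[\<gamma>\<^sub>r]\<close> is a multiple of \<open>[\<beta>\<^sub>r]\<close>.

  \<^item> \<open>\<alpha>\<^sub>r \<and> \<gamma>\<^sub>r\<close> is the coefficient of \<open>\<alpha> \<and> d\<alpha>\<close>. Its sign \<open>\<epsilon>\<close> is constant on the connected manifold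
    \<open>M\<close>. So the multiple has the sign \<open>s \<epsilon>\<close>.

  Now let the slope \<open>k\<close> satisfy \<open>k(b) = -k(a)\<close>. By the first fact \<open>s [\<alpha>\<^sub>r] \<and> k(a)\<close> is positive at \<open>r = a\<close>
  and negative at \<open>r = b\<close>, so its derivative is negative at some \<open>r\<close> between them. By the other two
  facts this says that \<open>\<epsilon>\<close> is the sign of \<open>k(r) \<and> k(a)\<close>. On the clockwise arc from \<open>k(a)\<close> to \<open>-k(a)\<close>
  this wedge is positive, on the opposite arc negative. Hence a positive half-twisting region forces
  \<open>\<epsilon> > 0\<close>, a negative one \<open>\<epsilon> < 0\<close>, and \<open>X\<close> cannot admit both.

  The torus part of the argument is \<open>half_twist_direction\<close>, based on \<open>riemann_bilinear\<close>;
  \<open>half_twist_sign\<close> transfers it to the manifold, where \<open>d1_pullback1\<close> and \<open>flux_closed\<close> say that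
  exterior derivatives commute with the passage to the coordinates \<open>x, y, r\<close>.\<close>

section \<open>Calculus of smooth maps\<close>

lemma has_derivative_D: "f differentiable (at x) \<Longrightarrow> (f has_derivative D f x) (at x)"
  by (simp add: frechet_derivative_works)

lemma D_eqI: "(f has_derivative f') (at x) \<Longrightarrow> D f x = f'"
  by (metis frechet_derivative_at)

lemma D_cong_open:
  assumes "open S" "x \<in> S" "\<And>y. y \<in> S \<Longrightarrow> f y = g y"
  shows "D f x = D g x"
proof -
  have "(f has_derivative h) (at x) \<longleftrightarrow> (g has_derivative h) (at x)" for h
    using assms has_derivative_transform_within_open by (metis (no_types, lifting))
  then show ?thesis by (simp add: frechet_derivative_def)
qed

lemma Ck_on_cong:
  assumes "open S" "\<And>x. x \<in> S \<Longrightarrow> f x = g x" "Ck_on k S f"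
  shows "Ck_on k S g"
  using assms(2,3)
proof (induction k arbitrary: f g)
  case 0
  then show ?case using continuous_on_cong by (metis Ck_on.simps(1))
next
  case (Suc k)
  have "g differentiable (at x)" if "x \<in> S" for x
    using Suc.prems that assms(1) unfolding differentiable_def
    by (metis Ck_on.simps(2) differentiable_def has_derivative_transform_within_open)
  moreover have "Ck_on k S (\<lambda>x. D g x v)" for v
  proof (rule Suc.IH)
    show "D f x v = D g x v" if "x \<in> S" for x
      using D_cong_open[OF assms(1) that] Suc.prems(1) by metis
    show "Ck_on k S (\<lambda>x. D f x v)" using Suc.prems(2) by simp
  qed
  ultimately show ?case by simp
qed

lemma Ck_on_local:
  assumes "\<And>x. x \<in> S \<Longrightarrow> \<exists>T. open T \<and> x \<in> T \<and> Ck_on k T f"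
  shows "Ck_on k S f"
  using assms
proof (induction k arbitrary: f)
  case 0
  then show ?case
    by (metis Ck_on.simps(1) continuous_at_imp_continuous_on continuous_on_eq_continuous_at)
next
  case (Suc k)
  have "Ck_on k S (\<lambda>x. D f x v)" for v
    using Suc.prems by (intro Suc.IH) (metis Ck_on.simps(2))
  then show ?case using Suc.prems by (metis Ck_on.simps(2))
qed

lemma Ck_on_Suc_imp: "Ck_on (Suc k) S f \<Longrightarrow> Ck_on k S f"
proof (induction k arbitrary: f)
  case 0
  then show ?case
    by (auto intro: differentiable_imp_continuous_within continuous_at_imp_continuous_on)
next
  case (Suc k)
  then show ?case by (metis Ck_on.simps(2))
qed

lemma Ck_on_const: "Ck_on k S (\<lambda>x. c)"
  by (induction k arbitrary: c) auto

lemma Ck_on_SucI: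
  assumes "open S" "\<And>x. x \<in> S \<Longrightarrow> (f has_derivative f' x) (at x)" "\<And>v. Ck_on k S (\<lambda>x. f' x v)"
  shows "Ck_on (Suc k) S f"
proof -
  have "Ck_on k S (\<lambda>x. D f x v)" for v
    by (rule Ck_on_cong[OF assms(1) _ assms(3)[of v]]) (metis assms(2) D_eqI)
  then show ?thesis using assms(2) by (auto simp: differentiable_def)
qed

lemma Ck_on_has_derivative: "Ck_on (Suc k) S f \<Longrightarrow> x \<in> S \<Longrightarrow> (f has_derivative D f x) (at x)"
  using frechet_derivative_works by auto

lemma Ck_on_add:
  assumes "open S" "Ck_on k S f" "Ck_on k S g"
  shows "Ck_on k S (\<lambda>x. f x + g x)"
  using assms(2,3)
proof (induction k arbitrary: f g)
  case 0
  then show ?case by (auto intro: continuous_intros)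
next
  case (Suc k)
  show ?case
    by (rule Ck_on_SucI[OF assms(1), of _ "\<lambda>x v. D f x v + D g x v"])
      (use Suc in \<open>auto intro!: has_derivative_add has_derivative_D\<close>)
qed

lemma Ck_on_sum:
  assumes "open S" "finite I" "\<And>i. i \<in> I \<Longrightarrow> Ck_on k S (f i)"
  shows "Ck_on k S (\<lambda>x. \<Sum>i\<in>I. f i x)"
  using assms(2,3) by (induction I) (auto intro: Ck_on_add[OF assms(1)] Ck_on_const)

lemma (in bounded_linear) Ck_on:
  assumes "open S" "Ck_on k S g"
  shows "Ck_on k S (\<lambda>x. f (g x))"
  using assms(2)
proof (induction k arbitrary: g)
  case 0
  then show ?case by (auto intro: continuous_on)
next
  case (Suc k)
  show ?case
    by (rule Ck_on_SucI[OF assms(1), of _ "\<lambda>x v. f (D g x v)"])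
      (use Suc in \<open>auto intro!: has_derivative has_derivative_D\<close>)
qed

lemma (in bounded_bilinear) Ck_on:
  assumes "open S" "Ck_on k S f" "Ck_on k S g"
  shows "Ck_on k S (\<lambda>x. prod (f x) (g x))"
  using assms(2,3)
proof (induction k arbitrary: f g)
  case 0
  then show ?case by (auto intro: continuous_on)
next
  case (Suc k)
  have "Ck_on k S f" "Ck_on k S g" using Suc.prems Ck_on_Suc_imp by blast+
  then show ?case
    by (intro Ck_on_SucI[OF assms(1), of _ "\<lambda>x v. prod (f x) (D g x v) + prod (D f x v) (g x)"])
      (use Suc in \<open>auto intro!: FDERIV has_derivative_D Ck_on_add[OF assms(1)]\<close>)
qed

text \<open>The derivative of \<open>g \<circ> f\<close> in direction \<open>v\<close> is expanded in a basis, because only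
  \<open>x \<mapsto> D g x b\<close> with a fixed vector \<open>b\<close> is known to be of class \<open>C\<^sup>k\<close>.\<close>

lemma Ck_on_compose:
  fixes f :: "'a::real_normed_vector \<Rightarrow> 'b::euclidean_space"
  assumes "open S" "Ck_on k S f" "Ck_on k T g" "f ` S \<subseteq> T"
  shows "Ck_on k S (\<lambda>x. g (f x))"
  using assms(2,3)
proof (induction k arbitrary: g)
  case 0
  then show ?case using assms(4) by (auto intro: continuous_on_compose2)
next
  case (Suc k)
  show ?case
  proof (rule Ck_on_SucI[OF assms(1)])
    fix x assume x: "x \<in> S"
    show "((\<lambda>x. g (f x)) has_derivative (\<lambda>v. \<Sum>b\<in>Basis. (D f x v \<bullet> b) *\<^sub>R D g (f x) b)) (at x)"
    proof -
      have g: "(g has_derivative D g (f x)) (at (f x))"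
        using Suc.prems(2) x assms(4) by (intro Ck_on_has_derivative) auto
      have "((\<lambda>x. g (f x)) has_derivative (\<lambda>v. D g (f x) (D f x v))) (at x)"
        by (rule has_derivative_compose[OF Ck_on_has_derivative[OF Suc.prems(1) x] g])
      moreover have "D g (f x) w = (\<Sum>b\<in>Basis. (w \<bullet> b) *\<^sub>R D g (f x) b)" for w
      proof -
        interpret bounded_linear "D g (f x)" using g by (rule has_derivative_bounded_linear)
        have "D g (f x) (\<Sum>b\<in>Basis. (w \<bullet> b) *\<^sub>R b) = (\<Sum>b\<in>Basis. (w \<bullet> b) *\<^sub>R D g (f x) b)"
          by (simp add: sum scale)
        then show ?thesis by (simp add: euclidean_representation)
      qed
      then have "(\<lambda>v. D g (f x) (D f x v)) = (\<lambda>v. \<Sum>b\<in>Basis. (D f x v \<bullet> b) *\<^sub>R D g (f x) b)"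
        by blast
      ultimately show ?thesis by (simp only:)
    qed
  next
    fix v
    have "Ck_on k S (\<lambda>x. D g (f x) b)" for b
      using Ck_on_Suc_imp[OF Suc.prems(1)] Suc.prems(2) by (intro Suc.IH) auto
    moreover have "Ck_on k S (\<lambda>x. D f x v \<bullet> b)" for b
      using Suc.prems(1) by (intro bounded_linear.Ck_on[OF bounded_linear_inner_left assms(1)]) simp
    ultimately show "Ck_on k S (\<lambda>x. \<Sum>b\<in>Basis. (D f x v \<bullet> b) *\<^sub>R D g (f x) b)"
      by (intro Ck_on_sum[OF assms(1)] bounded_bilinear.Ck_on[OF bounded_bilinear_scaleR assms(1)]) auto
  qed
qed

lemma smooth_on_has_derivative:
  "smooth_on S f \<Longrightarrow> x \<in> S \<Longrightarrow> (f has_derivative D f x) (at x)"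
  unfolding smooth_on_def using Ck_on_has_derivative by blast

lemma smooth_on_continuous: "smooth_on S f \<Longrightarrow> continuous_on S f"
  unfolding smooth_on_def using Ck_on.simps(1) by blast

lemma smooth_on_D: "smooth_on S f \<Longrightarrow> smooth_on S (\<lambda>x. D f x v)"
  unfolding smooth_on_def by (metis Ck_on.simps(2))

lemma smooth_onI_derivative:
  assumes "open S" "\<And>x. x \<in> S \<Longrightarrow> (f has_derivative f' x) (at x)" "\<And>v. smooth_on S (\<lambda>x. f' x v)"
  shows "smooth_on S f"
  unfolding smooth_on_def
proof
  fix k
  have "Ck_on (Suc k) S f"
    using assms by (intro Ck_on_SucI) (auto simp: smooth_on_def)
  then show "Ck_on k S f" by (rule Ck_on_Suc_imp)
qed

lemma smooth_on_cong:
  "open S \<Longrightarrow> (\<And>x. x \<in> S \<Longrightarrow> f x = g x) \<Longrightarrow> smooth_on S f \<Longrightarrow> smooth_on S g"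
  unfolding smooth_on_def using Ck_on_cong by blast

lemma smooth_on_local:
  "(\<And>x. x \<in> S \<Longrightarrow> \<exists>T. open T \<and> x \<in> T \<and> smooth_on T f) \<Longrightarrow> smooth_on S f"
  unfolding smooth_on_def by (intro allI Ck_on_local) blast

lemma smooth_on_const: "smooth_on S (\<lambda>x. c)"
  by (simp add: smooth_on_def Ck_on_const)

lemma smooth_on_add: "open S \<Longrightarrow> smooth_on S f \<Longrightarrow> smooth_on S g \<Longrightarrow> smooth_on S (\<lambda>x. f x + g x)"
  by (simp add: smooth_on_def Ck_on_add)

lemma smooth_on_sum:
  "open S \<Longrightarrow> finite I \<Longrightarrow> (\<And>i. i \<in> I \<Longrightarrow> smooth_on S (f i)) \<Longrightarrow> smooth_on S (\<lambda>x. \<Sum>i\<in>I. f i x)"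
  by (simp add: smooth_on_def Ck_on_sum)

lemma smooth_on_linear:
  "bounded_linear h \<Longrightarrow> open S \<Longrightarrow> smooth_on S f \<Longrightarrow> smooth_on S (\<lambda>x. h (f x))"
  by (simp add: smooth_on_def bounded_linear.Ck_on)

lemma smooth_on_bilinear:
  "bounded_bilinear h \<Longrightarrow> open S \<Longrightarrow> smooth_on S f \<Longrightarrow> smooth_on S g \<Longrightarrow> smooth_on S (\<lambda>x. h (f x) (g x))"
  by (simp add: smooth_on_def bounded_bilinear.Ck_on)

lemmas smooth_on_mult = smooth_on_bilinear[OF bounded_bilinear_mult]

lemma smooth_on_diff:
  "open S \<Longrightarrow> smooth_on S f \<Longrightarrow> smooth_on S g \<Longrightarrow> smooth_on S (\<lambda>x. f x - g x)"
  using smooth_on_add[of S f "\<lambda>x. - g x"]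
    smooth_on_linear[OF bounded_linear_minus[OF bounded_linear_ident], of S g] by simp

lemma smooth_on_compose:
  fixes f :: "'a::real_normed_vector \<Rightarrow> 'b::euclidean_space"
  shows "open S \<Longrightarrow> smooth_on S f \<Longrightarrow> smooth_on T g \<Longrightarrow> f ` S \<subseteq> T \<Longrightarrow> smooth_on S (\<lambda>x. g (f x))"
  unfolding smooth_on_def using Ck_on_compose by blast

text \<open>Second derivatives commute. The second difference of \<open>f\<close> over a parallelogram is
  \<open>h\<^sup>2\<close> times a value of either iterated derivative nearby, by two applications of the mean value
  theorem; continuity then identifies the two iterated derivatives.\<close>

lemma second_difference:
  fixes f :: "'a::real_normed_vector \<Rightarrow> real"
  assumes "smooth_on S f" "h > 0"
    and S: "\<And>s t. 0 \<le> s \<Longrightarrow> s \<le> h \<Longrightarrow> 0 \<le> t \<Longrightarrow> t \<le> h \<Longrightarrow> x + s *\<^sub>R u + t *\<^sub>R v \<in> S"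
  shows "\<exists>s t. 0 < s \<and> s < h \<and> 0 < t \<and> t < h \<and>
    f (x + h *\<^sub>R u + h *\<^sub>R v) - f (x + h *\<^sub>R u) - f (x + h *\<^sub>R v) + f x
      = h\<^sup>2 * D (\<lambda>y. D f y u) (x + s *\<^sub>R u + t *\<^sub>R v) v"
proof -
  have line: "((\<lambda>t. g (p + t *\<^sub>R w)) has_real_derivative D g (p + t *\<^sub>R w) w) (at t)"
    if "smooth_on S g" "p + t *\<^sub>R w \<in> S" for g :: "'a \<Rightarrow> real" and p w t
  proof -
    have 1: "((\<lambda>t. p + t *\<^sub>R w) has_derivative (\<lambda>s. s *\<^sub>R w)) (at t)"
      by (auto intro!: derivative_eq_intros)
    have 2: "(g has_derivative D g (p + t *\<^sub>R w)) (at (p + t *\<^sub>R w))"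
      using smooth_on_has_derivative that by blast
    have "D g (p + t *\<^sub>R w) (s *\<^sub>R w) = D g (p + t *\<^sub>R w) w * s" for s
      using linear_scale[OF bounded_linear.linear[OF has_derivative_bounded_linear[OF 2]], of s w]
      by simp
    then show ?thesis
      using has_derivative_compose[OF 1 2] by (simp add: has_field_derivative_def)
  qed
  let ?A = "\<lambda>s. f (x + s *\<^sub>R u + h *\<^sub>R v) - f (x + s *\<^sub>R u)"
  have "(?A has_real_derivative D f (x + s *\<^sub>R u + h *\<^sub>R v) u - D f (x + s *\<^sub>R u) u) (at s)"
    if "0 \<le> s" "s \<le> h" for s
  proof (rule DERIV_diff)
    show "((\<lambda>s. f (x + s *\<^sub>R u + h *\<^sub>R v)) has_real_derivative D f (x + s *\<^sub>R u + h *\<^sub>R v) u) (at s)"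
      using line[OF assms(1), of "x + h *\<^sub>R v" s u] S[of s h] that assms(2) by (simp add: ac_simps)
    show "((\<lambda>s. f (x + s *\<^sub>R u)) has_real_derivative D f (x + s *\<^sub>R u) u) (at s)"
      using line[OF assms(1), of x s u] S[of s 0] that assms(2) by simp
  qed
  from MVT2[OF assms(2) this] obtain s where s: "0 < s" "s < h"
    and sA: "?A h - ?A 0 = h * (D f (x + s *\<^sub>R u + h *\<^sub>R v) u - D f (x + s *\<^sub>R u) u)"
    by auto
  have "((\<lambda>t. D f (x + s *\<^sub>R u + t *\<^sub>R v) u) has_real_derivative
      D (\<lambda>y. D f y u) (x + s *\<^sub>R u + t *\<^sub>R v) v) (at t)" if "0 \<le> t" "t \<le> h" for t
    using line[OF smooth_on_D[OF assms(1), of u], of "x + s *\<^sub>R u" t v] S[of s t] s that by simp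
  from MVT2[OF assms(2) this] obtain t where t: "0 < t" "t < h"
    and tA: "D f (x + s *\<^sub>R u + h *\<^sub>R v) u - D f (x + s *\<^sub>R u) u
      = h * D (\<lambda>y. D f y u) (x + s *\<^sub>R u + t *\<^sub>R v) v"
    by auto
  show ?thesis
    using s t sA tA by (intro exI[of _ s] exI[of _ t]) (simp add: power2_eq_square)
qed

lemma D_commute_real:
  fixes f :: "'a::real_normed_vector \<Rightarrow> real"
  assumes "open S" "smooth_on S f" "x \<in> S"
  shows "D (\<lambda>y. D f y u) x v = D (\<lambda>y. D f y v) x u"
proof (rule ccontr)
  let ?p = "\<lambda>y. D (\<lambda>y. D f y u) y v" and ?q = "\<lambda>y. D (\<lambda>y. D f y v) y u"
  assume ne: "?p x \<noteq> ?q x"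
  define e where "e = \<bar>?p x - ?q x\<bar> / 2"
  have e: "e > 0" using ne by (simp add: e_def)
  have cont: "isCont ?p x" "isCont ?q x"
    using assms smooth_on_continuous[OF smooth_on_D[OF smooth_on_D[OF assms(2)]]]
    by (auto simp: continuous_on_eq_continuous_at)
  obtain d1 where d1: "d1 > 0" "\<And>y. dist y x < d1 \<Longrightarrow> dist (?p y) (?p x) < e"
    using cont(1) e unfolding continuous_at_eps_delta by metis
  obtain d2 where d2: "d2 > 0" "\<And>y. dist y x < d2 \<Longrightarrow> dist (?q y) (?q x) < e"
    using cont(2) e unfolding continuous_at_eps_delta by metis
  obtain d3 where d3: "d3 > 0" "ball x d3 \<subseteq> S"
    using assms(1,3) open_contains_ball by blast
  define d where "d = min d1 (min d2 d3)"
  define h where "h = d / (2 * (norm u + norm v + 1))"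
  have N: "norm u + norm v + 1 > 0" using norm_ge_zero[of u] norm_ge_zero[of v] by linarith
  have d: "d > 0" using d1 d2 d3 by (simp add: d_def)
  have h: "h > 0" using d N by (simp add: h_def)
  have hd: "h * (norm u + norm v + 1) = d / 2"
  proof -
    have "d / (2 * K) * K = d / 2" if "K > 0" for K :: real using that by simp
    from this[OF N] show ?thesis unfolding h_def .
  qed
  have near: "dist (x + s *\<^sub>R u + t *\<^sub>R v) x < d" if "0 \<le> s" "s \<le> h" "0 \<le> t" "t \<le> h" for s t
  proof -
    have "dist (x + s *\<^sub>R u + t *\<^sub>R v) x = norm (s *\<^sub>R u + t *\<^sub>R v)" by (simp add: dist_norm add.assoc)
    also have "\<dots> \<le> s * norm u + t * norm v"
      using norm_triangle_ineq[of "s *\<^sub>R u" "t *\<^sub>R v"] that by simp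
    also have "\<dots> \<le> h * norm u + h * norm v"
      using that by (intro add_mono mult_right_mono) auto
    also have "\<dots> \<le> d / 2" using h hd by (simp add: algebra_simps)
    also have "\<dots> < d" using d by simp
    finally show ?thesis .
  qed
  have inS: "x + s *\<^sub>R u + t *\<^sub>R v \<in> S" if "0 \<le> s" "s \<le> h" "0 \<le> t" "t \<le> h" for s t
    using near[OF that] d3(2) by (auto simp: d_def dist_commute)
  obtain s t where st: "0 < s" "s < h" "0 < t" "t < h" and
    1: "f (x + h *\<^sub>R u + h *\<^sub>R v) - f (x + h *\<^sub>R u) - f (x + h *\<^sub>R v) + f x
      = h\<^sup>2 * ?p (x + s *\<^sub>R u + t *\<^sub>R v)"
    using second_difference[OF assms(2) h, of x u v] inS by blast
  have "x + s *\<^sub>R v + t *\<^sub>R u \<in> S" if "0 \<le> s" "s \<le> h" "0 \<le> t" "t \<le> h" for s t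
    using inS[of t s] that by (simp add: ac_simps)
  then obtain s' t' where st': "0 < s'" "s' < h" "0 < t'" "t' < h" and
    2: "f (x + h *\<^sub>R v + h *\<^sub>R u) - f (x + h *\<^sub>R v) - f (x + h *\<^sub>R u) + f x
      = h\<^sup>2 * ?q (x + s' *\<^sub>R v + t' *\<^sub>R u)"
    using second_difference[OF assms(2) h, of x v u] by blast
  have "h\<^sup>2 * ?p (x + s *\<^sub>R u + t *\<^sub>R v) = h\<^sup>2 * ?q (x + t' *\<^sub>R u + s' *\<^sub>R v)"
  proof -
    have swap: "x + a *\<^sub>R v + b *\<^sub>R u = x + b *\<^sub>R u + a *\<^sub>R v" for a b by simp
    show ?thesis using 1 2 unfolding swap by linarith
  qed
  then have eq: "?p (x + s *\<^sub>R u + t *\<^sub>R v) = ?q (x + t' *\<^sub>R u + s' *\<^sub>R v)" using h by simp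
  have "dist (?p (x + s *\<^sub>R u + t *\<^sub>R v)) (?p x) < e" "dist (?q (x + t' *\<^sub>R u + s' *\<^sub>R v)) (?q x) < e"
    using near[of s t] near[of t' s'] st st' by (auto intro!: d1(2) d2(2) simp: d_def)
  then show False using eq unfolding dist_real_def e_def by argo
qed

lemma D_commute:
  fixes f :: "'a::real_normed_vector \<Rightarrow> real^'n"
  assumes "open S" "smooth_on S f" "x \<in> S"
  shows "D (\<lambda>y. D f y u) x v = D (\<lambda>y. D f y v) x u"
proof -
  have comp: "D (\<lambda>y. g y $ i) y w = D g y w $ i" if "smooth_on S g" "y \<in> S" for g :: "'a \<Rightarrow> real^'n" and y w i
    using D_eqI[OF bounded_linear.has_derivative[OF bounded_linear_vec_nth
          smooth_on_has_derivative[OF that], of i]] by metis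
  have "D (\<lambda>y. D f y u) x v $ i = D (\<lambda>y. D f y v) x u $ i" for i
  proof -
    have fi: "smooth_on S (\<lambda>y. f y $ i)"
      by (rule smooth_on_linear[OF bounded_linear_vec_nth assms(1,2)])
    have "D (\<lambda>y. D f y a) x b $ i = D (\<lambda>y. D (\<lambda>y. f y $ i) y a) x b" for a b
    proof -
      have "D (\<lambda>y. D (\<lambda>y. f y $ i) y a) x = D (\<lambda>y. D f y a $ i) x"
        by (rule D_cong_open[OF assms(1,3)]) (rule comp[OF assms(2)])
      then show ?thesis using comp[OF smooth_on_D[OF assms(2)] assms(3)] by metis
    qed
    then show ?thesis using D_commute_real[OF assms(1) fi assms(3)] by simp
  qed
  then show ?thesis by (simp add: vec_eq_iff)
qed

section \<open>Closed one-forms on the torus\<close>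

lemma has_real_derivative_along_line:
  fixes f :: "'a::real_normed_vector \<Rightarrow> real"
  assumes "(f has_derivative f') (at (z + t *\<^sub>R v))"
  shows "((\<lambda>t. f (z + t *\<^sub>R v)) has_real_derivative f' v) (at t)"
proof -
  have 1: "((\<lambda>t. z + t *\<^sub>R v) has_derivative (\<lambda>s. s *\<^sub>R v)) (at t)"
    by (auto intro!: derivative_eq_intros)
  have "f' (s *\<^sub>R v) = f' v * s" for s
    using linear_scale[OF bounded_linear.linear[OF has_derivative_bounded_linear[OF assms]], of s v]
    by simp
  then show ?thesis
    using has_derivative_compose[OF 1 assms] by (simp add: has_field_derivative_def)
qed

text \<open>The Poincare lemma for a smooth closed one-form, written \<open>\<eta> z \<bullet> v\<close>. The primitive integrates
  the form along the segment from the origin; closedness turns the derivative of the integrand in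
  direction \<open>v\<close> into a total derivative along the segment.\<close>

lemma closed_form_exact:
  fixes \<eta> :: "'a::euclidean_space \<Rightarrow> 'a"
  assumes sm: "smooth_on UNIV \<eta>" and closed: "\<And>z u v. D \<eta> z u \<bullet> v = D \<eta> z v \<bullet> u"
  obtains f where "\<And>z. (f has_derivative (\<lambda>v. \<eta> z \<bullet> v)) (at z)"
proof -
  define f where "f z = integral {0..1} (\<lambda>s::real. \<eta> (s *\<^sub>R z) \<bullet> z)" for z
  have der: "(\<eta> has_derivative D \<eta> z) (at z)" for z
    using smooth_on_has_derivative[OF sm] by simp
  have cont: "continuous_on UNIV \<eta>" "continuous_on UNIV (\<lambda>z. D \<eta> z v)" for v
    by (intro smooth_on_continuous smooth_on_D sm)+
  have line: "((\<lambda>t. f (z + t *\<^sub>R v)) has_real_derivative \<eta> (z + t0 *\<^sub>R v) \<bullet> v) (at t0)" for z v t0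
  proof -
    let ?p = "\<lambda>t. z + t *\<^sub>R v"
    let ?g = "\<lambda>t s. s * (D \<eta> (s *\<^sub>R ?p t) v \<bullet> ?p t) + \<eta> (s *\<^sub>R ?p t) \<bullet> v"
    have "((\<lambda>t. integral (cbox 0 1) (\<lambda>s. \<eta> (s *\<^sub>R ?p t) \<bullet> ?p t)) has_field_derivative
        integral (cbox 0 1) (?g t0)) (at t0 within UNIV)"
    proof (rule leibniz_rule_field_derivative)
      fix t s :: real
      have "((\<lambda>t. \<eta> (s *\<^sub>R ?p t) \<bullet> ?p t) has_derivative
          (\<lambda>h. \<eta> (s *\<^sub>R ?p t) \<bullet> (h *\<^sub>R v) + D \<eta> (s *\<^sub>R ?p t) (s *\<^sub>R h *\<^sub>R v) \<bullet> ?p t)) (at t)"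
        by (intro has_derivative_inner has_derivative_compose[OF _ der, of "\<lambda>t. s *\<^sub>R ?p t"])
          (auto intro!: derivative_eq_intros)
      moreover have "(\<lambda>h. \<eta> (s *\<^sub>R ?p t) \<bullet> (h *\<^sub>R v) + D \<eta> (s *\<^sub>R ?p t) (s *\<^sub>R h *\<^sub>R v) \<bullet> ?p t) = (*) (?g t s)"
      proof
        fix h
        have "D \<eta> w (s *\<^sub>R h *\<^sub>R v) = (s * h) *\<^sub>R D \<eta> w v" for w
          using linear_scale[OF bounded_linear.linear[OF has_derivative_bounded_linear[OF der]], of w "s * h" v]
          by simp
        then show "\<eta> (s *\<^sub>R ?p t) \<bullet> (h *\<^sub>R v) + D \<eta> (s *\<^sub>R ?p t) (s *\<^sub>R h *\<^sub>R v) \<bullet> ?p t = ?g t s * h"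
          by (simp only: inner_scaleR_left inner_scaleR_right) (simp only: algebra_simps)
      qed
      ultimately show "((\<lambda>t. \<eta> (s *\<^sub>R ?p t) \<bullet> ?p t) has_field_derivative ?g t s) (at t within UNIV)"
        by (simp only: has_field_derivative_def)
    next
      show "(\<lambda>s. \<eta> (s *\<^sub>R ?p t) \<bullet> ?p t) integrable_on cbox 0 1" for t
        by (intro integrable_continuous continuous_intros continuous_on_compose2[OF cont(1)]) auto
      show "continuous_on (UNIV \<times> cbox 0 1) (\<lambda>(t, s). ?g t s)"
        unfolding split_beta
        by (intro continuous_intros continuous_on_compose2[OF cont(1)] continuous_on_compose2[OF cont(2)])
          auto
    qed auto
    moreover have "(?g t0 has_integral \<eta> (?p t0) \<bullet> v) (cbox 0 1)"
    proof -
      have "((\<lambda>s. s * (\<eta> (s *\<^sub>R ?p t0) \<bullet> v)) has_vector_derivative ?g t0 s) (at s within {0..1})" for s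
      proof -
        have ray: "((\<lambda>s. \<eta> (s *\<^sub>R ?p t0) \<bullet> v) has_real_derivative D \<eta> (s *\<^sub>R ?p t0) (?p t0) \<bullet> v) (at s)"
          using has_real_derivative_along_line[of "\<lambda>z. \<eta> z \<bullet> v" _ 0 s "?p t0"]
            has_derivative_inner_left[OF der] by fastforce
        have "((\<lambda>s. s * (\<eta> (s *\<^sub>R ?p t0) \<bullet> v)) has_real_derivative ?g t0 s) (at s)"
        proof (rule DERIV_cong[OF DERIV_mult[OF DERIV_ident ray]])
          have "1 * a + b * s = s * c + a" if "b = c" for a b c :: real using that by simp
          from this[OF closed] show "1 * (\<eta> (s *\<^sub>R ?p t0) \<bullet> v) + D \<eta> (s *\<^sub>R ?p t0) (?p t0) \<bullet> v * s
              = ?g t0 s" .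
        qed
        from has_field_derivative_at_within[OF this] show ?thesis
          by (simp only: has_real_derivative_iff_has_vector_derivative)
      qed
      from fundamental_theorem_of_calculus[OF _ this] show ?thesis by simp
    qed
    ultimately show ?thesis by (simp add: f_def integral_unique)
  qed
  have "(f has_derivative (\<lambda>v. \<eta> z \<bullet> v)) (at z)" for z
    unfolding has_derivative_at_alt
  proof (intro conjI allI impI bounded_linear_inner_right)
    fix e :: real assume "e > 0"
    then obtain d where d: "d > 0" "\<And>y. dist y z < d \<Longrightarrow> dist (\<eta> y) (\<eta> z) < e"
      using cont(1) by (metis UNIV_I continuous_at_eps_delta continuous_on_eq_continuous_at open_UNIV)
    show "\<exists>d>0. \<forall>y. norm (y - z) < d \<longrightarrow> norm (f y - f z - \<eta> z \<bullet> (y - z)) \<le> e * norm (y - z)"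
    proof (intro exI[of _ d] conjI allI impI d)
      fix y assume y: "norm (y - z) < d"
      obtain t where t: "0 < t" "t < 1" and "f (z + 1 *\<^sub>R (y - z)) - f (z + 0 *\<^sub>R (y - z))
          = (1 - 0) * (\<eta> (z + t *\<^sub>R (y - z)) \<bullet> (y - z))"
        using MVT2[of 0 1 "\<lambda>t. f (z + t *\<^sub>R (y - z))" "\<lambda>t. \<eta> (z + t *\<^sub>R (y - z)) \<bullet> (y - z)"] line
        by auto
      then have "f y - f z - \<eta> z \<bullet> (y - z) = (\<eta> (z + t *\<^sub>R (y - z)) - \<eta> z) \<bullet> (y - z)"
        by (simp add: inner_diff_left)
      also have "norm \<dots> \<le> norm (\<eta> (z + t *\<^sub>R (y - z)) - \<eta> z) * norm (y - z)"
        using Cauchy_Schwarz_ineq2 by simp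
      also have "\<dots> \<le> e * norm (y - z)"
      proof (rule mult_right_mono)
        have "t * norm (y - z) \<le> 1 * norm (y - z)" using t by (intro mult_right_mono) auto
        then have "dist (z + t *\<^sub>R (y - z)) z < d" using t y by (simp add: dist_norm)
        then show "norm (\<eta> (z + t *\<^sub>R (y - z)) - \<eta> z) \<le> e"
          using d(2) by (simp add: dist_norm less_imp_le)
      qed simp
      finally show "norm (f y - f z - \<eta> z \<bullet> (y - z)) \<le> e * norm (y - z)" .
    qed
  qed
  then show thesis by (rule that)
qed

abbreviation e1 :: "real^2" where "e1 \<equiv> axis 1 1"
abbreviation e2 :: "real^2" where "e2 \<equiv> axis 2 1"

lemma expand2: "v = v $ 1 *\<^sub>R e1 + v $ 2 *\<^sub>R e2" for v :: "real^2"
  by (simp add: vec_eq_iff forall_2 axis_def)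

lemma linear_expand2:
  fixes h :: "real^2 \<Rightarrow> 'a::real_vector"
  assumes "linear h"
  shows "h v = v $ 1 *\<^sub>R h e1 + v $ 2 *\<^sub>R h e2"
proof -
  have "h v = h (v $ 1 *\<^sub>R e1 + v $ 2 *\<^sub>R e2)" by (rule arg_cong[OF expand2])
  then show ?thesis by (simp only: linear_add[OF assms] linear_scale[OF assms])
qed

lemma periodic_int_multiple:
  fixes f :: "'a::real_vector \<Rightarrow> 'b"
  assumes "\<And>z. f (z + v) = f z"
  shows "f (z + of_int n *\<^sub>R v) = f z"
proof (induction n arbitrary: z rule: int_induct[where k = 0])
  case (step1 i)
  then show ?case using assms[of "z + of_int i *\<^sub>R v"] by (simp add: algebra_simps)
next
  case (step2 i)
  then show ?case using assms[of "z + of_int (i - 1) *\<^sub>R v"] by (simp add: algebra_simps)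
qed simp

lemma torus_functionI:
  assumes "smooth_on UNIV f" "\<And>z. f (z + e1) = f z" "\<And>z. f (z + e2) = f z"
  shows "torus_function f"
  unfolding torus_function_def
proof (intro conjI allI impI)
  fix p q :: "real^2"
  assume "p $ 1 - q $ 1 \<in> \<int> \<and> p $ 2 - q $ 2 \<in> \<int>"
  then obtain m n :: int where "p $ 1 - q $ 1 = of_int m" "p $ 2 - q $ 2 = of_int n"
    by (auto elim!: Ints_cases)
  then have "p = (q + of_int m *\<^sub>R e1) + of_int n *\<^sub>R e2"
    by (simp add: vec_eq_iff forall_2 axis_def)
  then show "f p = f q"
    by (simp only: periodic_int_multiple[of f, OF assms(2)] periodic_int_multiple[of f, OF assms(3)])
qed (rule assms)

lemma torus_function_shift:
  assumes "torus_function f"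
  shows "f (z + e1) = f z" "f (z + e2) = f z"
  using assms unfolding torus_function_def by (auto simp: axis_def)

lemma torus_function_smooth: "torus_function f \<Longrightarrow> smooth_on UNIV f"
  by (simp add: torus_function_def)

lemma torus_function_derivative: "torus_function f \<Longrightarrow> (f has_derivative D f z) (at z)"
  using smooth_on_has_derivative torus_function_smooth by blast

lemma torus_function_continuous: "torus_function f \<Longrightarrow> continuous_on UNIV f"
  by (simp add: smooth_on_continuous torus_function_smooth)

lemma torus_function_mult: "torus_function f \<Longrightarrow> torus_function g \<Longrightarrow> torus_function (\<lambda>z. f z * g z)"
  unfolding torus_function_def using smooth_on_mult[OF open_UNIV] by metis

lemma torus_function_diff: "torus_function f \<Longrightarrow> torus_function g \<Longrightarrow> torus_function (\<lambda>z. f z - g z)"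
  unfolding torus_function_def using smooth_on_diff[OF open_UNIV] by metis

lemma D_shift:
  assumes "f differentiable (at (z + n))"
  shows "D (\<lambda>z. f (z + n)) z = D f (z + n)"
  by (rule D_eqI, rule has_derivative_compose[where f = "\<lambda>z. z + n" and f' = "\<lambda>v. v" and g = f])
    (auto intro!: derivative_eq_intros has_derivative_D assms)

lemma torus_function_D:
  assumes "torus_function f"
  shows "torus_function (\<lambda>z. D f z v)"
proof (rule torus_functionI)
  show "smooth_on UNIV (\<lambda>z. D f z v)" using assms smooth_on_D torus_function_smooth by blast
  have "f differentiable (at z)" for z
    using torus_function_derivative[OF assms] differentiableI by blast
  then show "D f (z + e1) v = D f z v" "D f (z + e2) v = D f z v" for z
    using D_shift[of f z e1] D_shift[of f z e2] torus_function_shift[OF assms] by auto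
qed

lemma torus_function_D_expand:
  assumes "torus_function f"
  shows "D f z v = v $ 1 * D f z e1 + v $ 2 * D f z e2"
proof -
  have "linear (D f z)"
    using has_derivative_bounded_linear[OF torus_function_derivative[OF assms]]
    by (rule bounded_linear.linear)
  from linear_expand2[OF this, of v] show ?thesis by simp
qed

text \<open>The average over a fundamental square; for the coefficients of a closed form it computes the
  de Rham class in the basis \<open>[dx], [dy]\<close>.\<close>

definition mean :: "(real^2 \<Rightarrow> real) \<Rightarrow> real" where
  "mean g = integral (cbox (0, 0) (1, 1)) (\<lambda>p. g (vector [fst p, snd p]))"

lemma vector2_eq: "(vector [x, y] :: real^2) = x *\<^sub>R e1 + y *\<^sub>R e2"
  by (simp add: vec_eq_iff forall_2 axis_def)

lemma continuous_on_vector2: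
  assumes "continuous_on UNIV g"
  shows "continuous_on S (\<lambda>p. g (vector [fst p, snd p] :: real^2))"
  unfolding vector2_eq
  by (intro continuous_on_compose2[OF assms] continuous_intros) auto

lemma mean_integrable:
  "continuous_on UNIV g \<Longrightarrow> (\<lambda>p. g (vector [fst p, snd p])) integrable_on cbox (0::real, 0::real) (1, 1)"
  for g :: "real^2 \<Rightarrow> real"
  by (intro integrable_continuous continuous_on_vector2)

lemma mean_diff:
  "continuous_on UNIV f \<Longrightarrow> continuous_on UNIV g \<Longrightarrow> mean (\<lambda>z. f z - g z) = mean f - mean g"
  unfolding mean_def by (intro integral_diff mean_integrable)

lemma mean_add:
  "continuous_on UNIV f \<Longrightarrow> continuous_on UNIV g \<Longrightarrow> mean (\<lambda>z. f z + g z) = mean f + mean g"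
  unfolding mean_def by (intro integral_add mean_integrable)

lemma mean_mult: "mean (\<lambda>z. c * f z) = c * mean f"
  unfolding mean_def by simp

lemma mean_const: "mean (\<lambda>z. c) = c"
  unfolding mean_def by (simp add: content_Pair)

lemma mean_pos:
  assumes "continuous_on UNIV g" "\<And>z. g z > 0"
  shows "mean g > 0"
proof -
  have "cbox (0::real, 0::real) (1, 1) \<noteq> {}" by (simp add: cbox_Pair_eq)
  from continuous_attains_inf[OF compact_cbox this continuous_on_vector2[OF assms(1)]]
  obtain p where p: "\<And>q. q \<in> cbox (0::real, 0::real) (1, 1) \<Longrightarrow>
      g (vector [fst p, snd p]) \<le> g (vector [fst q, snd q])" by blast
  have "mean (\<lambda>z. g (vector [fst p, snd p])) \<le> mean g"
    unfolding mean_def by (intro integral_le mean_integrable assms p continuous_intros) auto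
  then show ?thesis using assms(2) less_le_trans by (simp only: mean_const) blast
qed

lemma mean_D:
  assumes "torus_function g"
  shows "mean (\<lambda>z. D g z e1) = 0" "mean (\<lambda>z. D g z e2) = 0"
proof -
  have cont: "continuous_on S (\<lambda>p. D g (vector [fst p, snd p]) v)" for S v
    by (intro continuous_on_vector2 torus_function_continuous torus_function_D assms)
  have der: "(g has_derivative D g z) (at z)" for z by (rule torus_function_derivative[OF assms])
  have x: "integral (cbox 0 1) (\<lambda>x. D g (vector [x, y]) e1) = 0" for y
  proof -
    have "((\<lambda>x. g (y *\<^sub>R e2 + x *\<^sub>R e1)) has_vector_derivative D g (y *\<^sub>R e2 + x *\<^sub>R e1) e1)
        (at x within {0..1})" for x
      using has_field_derivative_at_within[OF has_real_derivative_along_line[OF der]]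
      by (simp only: has_real_derivative_iff_has_vector_derivative)
    from fundamental_theorem_of_calculus[OF _ this]
    have "((\<lambda>x. D g (vector [x, y]) e1) has_integral 0) (cbox 0 1)"
      using torus_function_shift(1)[OF assms, of "y *\<^sub>R e2"] by (simp add: vector2_eq add.commute)
    then show ?thesis by (rule integral_unique)
  qed
  have y: "integral (cbox 0 1) (\<lambda>y. D g (vector [x, y]) e2) = 0" for x
  proof -
    have "((\<lambda>y. g (x *\<^sub>R e1 + y *\<^sub>R e2)) has_vector_derivative D g (x *\<^sub>R e1 + y *\<^sub>R e2) e2)
        (at y within {0..1})" for y
      using has_field_derivative_at_within[OF has_real_derivative_along_line[OF der]]
      by (simp only: has_real_derivative_iff_has_vector_derivative)
    from fundamental_theorem_of_calculus[OF _ this]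
    have "((\<lambda>y. D g (vector [x, y]) e2) has_integral 0) (cbox 0 1)"
      using torus_function_shift(2)[OF assms, of "x *\<^sub>R e1"] by (simp add: vector2_eq)
    then show ?thesis by (rule integral_unique)
  qed
  show "mean (\<lambda>z. D g z e2) = 0"
    unfolding mean_def using y by (subst integral_prod_continuous[OF cont]) simp
  have "mean (\<lambda>z. D g z e1)
      = integral (cbox 0 1) (\<lambda>x. integral (cbox 0 1) (\<lambda>y. D g (vector [x, y]) e1))"
    unfolding mean_def by (subst integral_prod_continuous[OF cont]) simp
  also have "\<dots> = integral (cbox 0 1) (\<lambda>y. integral (cbox 0 1) (\<lambda>x. D g (vector [x, y]) e1))"
    by (rule integral_swap_continuous) (use cont[of _ e1] in \<open>simp add: split_beta\<close>)
  finally show "mean (\<lambda>z. D g z e1) = 0" using x by simp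
qed

definition closed_torus_form :: "(real^2 \<Rightarrow> real) \<Rightarrow> (real^2 \<Rightarrow> real) \<Rightarrow> bool" where
  "closed_torus_form \<eta>1 \<eta>2 \<longleftrightarrow> torus_function \<eta>1 \<and> torus_function \<eta>2 \<and>
     (\<forall>z. D \<eta>1 z e2 = D \<eta>2 z e1)"

text \<open>The partial derivatives of a periodic function average to zero, so averaging isolates the
  constant part of a form. This makes the de Rham class unique.\<close>

lemma primitive_means:
  assumes "torus_function f" "continuous_on UNIV \<eta>1" "continuous_on UNIV \<eta>2"
    and "\<And>z v. \<eta>1 z * v $ 1 + \<eta>2 z * v $ 2 = w1 * v $ 1 + w2 * v $ 2 + D f z v"
  shows "w1 = mean \<eta>1" "w2 = mean \<eta>2"
proof -
  have "D f z e1 = \<eta>1 z - w1" "D f z e2 = \<eta>2 z - w2" for z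
    using assms(4)[of z e1] assms(4)[of z e2] by (auto simp: axis_def)
  then show "w1 = mean \<eta>1" "w2 = mean \<eta>2"
    using mean_D[OF assms(1)] assms(2,3) by (auto simp: mean_diff mean_const)
qed

text \<open>De Rham's theorem in degree one for the torus: a primitive on the plane changes by a constant
  under each lattice translation, and subtracting the linear function with these periods makes it
  periodic.\<close>

lemma closed_torus_form_decompose:
  assumes "closed_torus_form \<eta>1 \<eta>2"
  obtains f where "torus_function f"
    and "\<And>z v. \<eta>1 z * v $ 1 + \<eta>2 z * v $ 2 = mean \<eta>1 * v $ 1 + mean \<eta>2 * v $ 2 + D f z v"
proof -
  have tf: "torus_function \<eta>1" "torus_function \<eta>2" and cl: "\<And>z. D \<eta>1 z e2 = D \<eta>2 z e1"
    using assms by (auto simp: closed_torus_form_def)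
  define \<eta> where "\<eta> = (\<lambda>z. \<eta>1 z *\<^sub>R e1 + \<eta>2 z *\<^sub>R e2)"
  have \<eta>v: "\<eta> z \<bullet> v = \<eta>1 z * v $ 1 + \<eta>2 z * v $ 2" for z v
    by (simp add: \<eta>_def inner_add_left inner_axis')
  have sm: "smooth_on UNIV \<eta>"
    unfolding \<eta>_def
    by (intro smooth_on_add smooth_on_bilinear[OF bounded_bilinear_scaleR] smooth_on_const
        torus_function_smooth tf) auto
  have D\<eta>: "D \<eta> z u = D \<eta>1 z u *\<^sub>R e1 + D \<eta>2 z u *\<^sub>R e2" for z u
  proof -
    have "(\<eta> has_derivative (\<lambda>u. D \<eta>1 z u *\<^sub>R e1 + D \<eta>2 z u *\<^sub>R e2)) (at z)"
      unfolding \<eta>_def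
      by (intro has_derivative_add has_derivative_scaleR_left torus_function_derivative tf)
    from D_eqI[OF this] show ?thesis by (simp only:)
  qed
  have "D \<eta> z u \<bullet> v = D \<eta> z v \<bullet> u" for z u v
  proof -
    have "D \<eta>1 z a = a $ 1 * D \<eta>1 z e1 + a $ 2 * D \<eta>1 z e2"
      "D \<eta>2 z a = a $ 1 * D \<eta>2 z e1 + a $ 2 * D \<eta>2 z e2" for a
      by (rule torus_function_D_expand[OF tf(1)], rule torus_function_D_expand[OF tf(2)])
    from this[of u] this[of v] show ?thesis
      by (simp only: D\<eta> cl inner_add_left inner_scaleR_left inner_axis')
        (simp add: algebra_simps)
  qed
  then obtain g where g: "\<And>z. (g has_derivative (\<lambda>v. \<eta> z \<bullet> v)) (at z)"
    using closed_form_exact[OF sm] by blast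
  have per: "g (z + n) - g z = g n - g 0" if "\<And>z. \<eta> (z + n) = \<eta> z" for n z
  proof -
    have "((\<lambda>z. g (z + n) - g z) has_derivative (\<lambda>v. 0)) (at z within UNIV)" for z
    proof -
      have "((\<lambda>z. z + n) has_derivative (\<lambda>v. v)) (at z)"
        by (auto intro!: derivative_eq_intros)
      from has_derivative_compose[OF this g]
      have "((\<lambda>z. g (z + n)) has_derivative (\<lambda>v. \<eta> z \<bullet> v)) (at z)"
        by (simp only: that)
      from has_derivative_diff[OF this g] show ?thesis by simp
    qed
    from has_derivative_zero_unique[OF convex_UNIV this, of z 0] show ?thesis by simp
  qed
  define c1 where "c1 = g e1 - g 0"
  define c2 where "c2 = g e2 - g 0"
  define f where "f = (\<lambda>z. g z - (c1 * z $ 1 + c2 * z $ 2))"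
  have fder: "(f has_derivative (\<lambda>v. \<eta> z \<bullet> v - (c1 * v $ 1 + c2 * v $ 2))) (at z)" for z
    unfolding f_def
    by (intro has_derivative_diff g has_derivative_add has_derivative_mult_right
        bounded_linear_imp_has_derivative bounded_linear_vec_nth)
  have smf: "smooth_on UNIV f"
    by (rule smooth_onI_derivative[OF open_UNIV fder], unfold \<eta>v,
        intro smooth_on_diff smooth_on_add smooth_on_mult smooth_on_const
        torus_function_smooth tf) auto
  have tf': "torus_function f"
  proof (rule torus_functionI[OF smf])
    have *: "\<eta> (z + e1) = \<eta> z" "\<eta> (z + e2) = \<eta> z" for z
      by (simp_all add: \<eta>_def torus_function_shift tf)
    show "f (z + e1) = f z" "f (z + e2) = f z" for z
      using per[OF *(1), of z] per[OF *(2), of z]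
      by (auto simp: f_def c1_def c2_def axis_def algebra_simps)
  qed
  have dec: "\<eta>1 z * v $ 1 + \<eta>2 z * v $ 2 = c1 * v $ 1 + c2 * v $ 2 + D f z v" for z v
    using D_eqI[OF fder[of z]] by (simp add: \<eta>v)
  show thesis
    using that[OF tf'] dec primitive_means[OF tf' _ _ dec] tf[THEN torus_function_continuous] by simp
qed

lemma torus_class_eq_means:
  assumes "closed_torus_form \<eta>1 \<eta>2"
  shows "torus_class (\<lambda>z v. \<eta>1 z * v $ 1 + \<eta>2 z * v $ 2) = Complex (mean \<eta>1) (mean \<eta>2)"
  unfolding torus_class_def
proof (rule the_equality)
  obtain f where "torus_function f"
    "\<And>z v. \<eta>1 z * v $ 1 + \<eta>2 z * v $ 2 = mean \<eta>1 * v $ 1 + mean \<eta>2 * v $ 2 + D f z v"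
    using closed_torus_form_decompose[OF assms] by blast
  then show "\<exists>f. torus_function f \<and> (\<forall>z v. \<eta>1 z * v $ 1 + \<eta>2 z * v $ 2 =
      Re (Complex (mean \<eta>1) (mean \<eta>2)) * v $ 1 + Im (Complex (mean \<eta>1) (mean \<eta>2)) * v $ 2 + D f z v)"
    by auto
next
  fix w assume "\<exists>f. torus_function f \<and> (\<forall>z v. \<eta>1 z * v $ 1 + \<eta>2 z * v $ 2 =
      Re w * v $ 1 + Im w * v $ 2 + D f z v)"
  then obtain f where f: "torus_function f"
    "\<And>z v. \<eta>1 z * v $ 1 + \<eta>2 z * v $ 2 = Re w * v $ 1 + Im w * v $ 2 + D f z v" by blast
  have "continuous_on UNIV \<eta>1" "continuous_on UNIV \<eta>2"
    using assms by (auto simp: closed_torus_form_def torus_function_continuous)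
  from primitive_means[OF f(1) this f(2)] show "w = Complex (mean \<eta>1) (mean \<eta>2)"
    by (simp add: complex_eq_iff)
qed

text \<open>The Riemann bilinear relation. After writing the second form as a constant form plus \<open>df\<close>,
  the remaining integrand is the divergence of the periodic vector field with components
  \<open>-\<eta>2 f\<close> and \<open>\<eta>1 f\<close>.\<close>

lemma riemann_bilinear:
  assumes \<eta>: "closed_torus_form \<eta>1 \<eta>2" and \<theta>: "closed_torus_form \<theta>1 \<theta>2"
  shows "mean (\<lambda>z. \<eta>1 z * \<theta>2 z - \<eta>2 z * \<theta>1 z) = mean \<eta>1 * mean \<theta>2 - mean \<eta>2 * mean \<theta>1"
proof -
  have tf: "torus_function \<eta>1" "torus_function \<eta>2" and cl: "\<And>z. D \<eta>1 z e2 = D \<eta>2 z e1"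
    using \<eta> by (auto simp: closed_torus_form_def)
  obtain f where f: "torus_function f"
    "\<And>z v. \<theta>1 z * v $ 1 + \<theta>2 z * v $ 2 = mean \<theta>1 * v $ 1 + mean \<theta>2 * v $ 2 + D f z v"
    using closed_torus_form_decompose[OF \<theta>] by blast
  have th: "\<theta>1 z = mean \<theta>1 + D f z e1" "\<theta>2 z = mean \<theta>2 + D f z e2" for z
    using f(2)[of z e1] f(2)[of z e2] by (auto simp: axis_def)
  have prod: "D (\<lambda>z. g z * f z) z v = g z * D f z v + D g z v * f z" if "torus_function g" for g z v
    unfolding D_eqI[OF has_derivative_mult[OF torus_function_derivative[OF that]
          torus_function_derivative[OF f(1)]]] by (rule refl)
  have tp: "torus_function (\<lambda>z. \<eta>1 z * f z)" "torus_function (\<lambda>z. \<eta>2 z * f z)"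
    using tf f torus_function_mult by auto
  have "\<eta>1 z * \<theta>2 z - \<eta>2 z * \<theta>1 z = (mean \<theta>2 * \<eta>1 z - mean \<theta>1 * \<eta>2 z)
      + (D (\<lambda>z. \<eta>1 z * f z) z e2 - D (\<lambda>z. \<eta>2 z * f z) z e1)" for z
    using th[of z] prod[OF tf(1), of z e2] prod[OF tf(2), of z e1] cl[of z] by algebra
  then have "mean (\<lambda>z. \<eta>1 z * \<theta>2 z - \<eta>2 z * \<theta>1 z) = mean (\<lambda>z. (mean \<theta>2 * \<eta>1 z - mean \<theta>1 * \<eta>2 z)
      + (D (\<lambda>z. \<eta>1 z * f z) z e2 - D (\<lambda>z. \<eta>2 z * f z) z e1))"
    by simp
  also have "\<dots> = mean \<theta>2 * mean \<eta>1 - mean \<theta>1 * mean \<eta>2 + (0 - 0)"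
    using tf tp
    by (simp add: mean_add mean_diff mean_mult mean_D torus_function_continuous torus_function_D
        continuous_on_mult_left continuous_on_diff)
  finally show ?thesis by simp
qed

section \<open>Families of torus forms\<close>

abbreviation E1 :: "real^3" where "E1 \<equiv> axis 1 1"
abbreviation E2 :: "real^3" where "E2 \<equiv> axis 2 1"
abbreviation E3 :: "real^3" where "E3 \<equiv> axis 3 1"

lemma expand3: "v = v $ 1 *\<^sub>R E1 + v $ 2 *\<^sub>R E2 + v $ 3 *\<^sub>R E3" for v :: "real^3"
  by (simp add: vec_eq_iff forall_3 axis_def)

lemma torus_vec_eq: "torus_vec v = v $ 1 *\<^sub>R E1 + v $ 2 *\<^sub>R E2"
  by (simp add: vec_eq_iff forall_3 axis_def)

lemma torus_pt_eq: "torus_pt z r = z $ 1 *\<^sub>R E1 + z $ 2 *\<^sub>R E2 + r *\<^sub>R E3"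
  by (simp add: vec_eq_iff forall_3 axis_def)

lemma torus_vec_axis: "torus_vec e1 = E1" "torus_vec e2 = E2"
  by (simp_all add: vec_eq_iff forall_3 axis_def)

lemma torus_pt_shift: "torus_pt (z + e1) r = torus_pt z r + E1" "torus_pt (z + e2) r = torus_pt z r + E2"
  by (simp_all add: vec_eq_iff forall_3 axis_def)

lemma torus_pt_derivative: "((\<lambda>z. torus_pt z r) has_derivative torus_vec) (at z)"
proof -
  have "((\<lambda>z. z $ 1 *\<^sub>R E1 + z $ 2 *\<^sub>R E2 + r *\<^sub>R E3) has_derivative
      (\<lambda>v. v $ 1 *\<^sub>R E1 + v $ 2 *\<^sub>R E2 + 0)) (at z)" for z :: "real^2"
    by (intro has_derivative_add has_derivative_scaleR_left has_derivative_const
        bounded_linear_imp_has_derivative bounded_linear_vec_nth)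
  then show ?thesis by (simp only: torus_pt_eq torus_vec_eq add_0_right scaleR_zero_left)
qed

lemma smooth_on_torus_pt: "smooth_on UNIV (\<lambda>z. torus_pt z r)"
  by (rule smooth_onI_derivative[OF open_UNIV torus_pt_derivative]) (rule smooth_on_const)

lemma slice_smooth:
  assumes "smooth_on V G" "slab {r} \<subseteq> V"
  shows "smooth_on UNIV (\<lambda>z. G (torus_pt z r))"
proof (rule smooth_on_compose[OF open_UNIV smooth_on_torus_pt assms(1)])
  show "range (\<lambda>z. torus_pt z r) \<subseteq> V" using assms(2) by (auto simp: slab_def)
qed

lemma slice_D:
  assumes "smooth_on V G" "slab {r} \<subseteq> V"
  shows "D (\<lambda>z. G (torus_pt z r)) z v = D G (torus_pt z r) (torus_vec v)"
proof -
  have "torus_pt z r \<in> V" using assms(2) by (auto simp: slab_def)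
  from D_eqI[OF has_derivative_compose[OF torus_pt_derivative smooth_on_has_derivative[OF assms(1) this]]]
  show ?thesis by (rule fun_cong)
qed

text \<open>Periodicity is required on the slab only: an extension to a neighbourhood of the slab need not be
  periodic beyond the boundary tori.\<close>

definition slab_periodic :: "real \<Rightarrow> real \<Rightarrow> (real^3 \<Rightarrow> 'b) \<Rightarrow> bool" where
  "slab_periodic a b G \<longleftrightarrow> (\<forall>q\<in>slab {a..b}. G (q + E1) = G q \<and> G (q + E2) = G q)"

lemma slice_torus_function:
  assumes "smooth_on V G" "slab {a..b} \<subseteq> V" "slab_periodic a b G" "r \<in> {a..b}"
  shows "torus_function (\<lambda>z. G (torus_pt z r))"
proof (rule torus_functionI)
  show "smooth_on UNIV (\<lambda>z. G (torus_pt z r))"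
    using assms(2,4) by (intro slice_smooth[OF assms(1)]) (auto simp: slab_def)
  have "torus_pt z r \<in> slab {a..b}" for z using assms(4) by (simp add: slab_def)
  then show "G (torus_pt (z + e1) r) = G (torus_pt z r)" "G (torus_pt (z + e2) r) = G (torus_pt z r)" for z
    using assms(3) by (simp_all only: torus_pt_shift slab_periodic_def)
qed

lemma slab_open: "open S \<Longrightarrow> open (slab S)"
  unfolding slab_def using open_vimage[of S "\<lambda>q::real^3. q $ 3"]
  by (simp add: vimage_def continuous_intros)

text \<open>The interior of the slab is an open set invariant under the lattice, so derivatives in all
  directions inherit periodicity there.\<close>

lemma slice_torus_function_D:
  assumes "smooth_on V G" "slab {a..b} \<subseteq> V" "slab_periodic a b G" "r \<in> {a<..<b}"
  shows "torus_function (\<lambda>z. D G (torus_pt z r) v)"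
proof (rule torus_functionI)
  show "smooth_on UNIV (\<lambda>z. D G (torus_pt z r) v)"
    using assms(2,4) by (intro slice_smooth[OF smooth_on_D[OF assms(1)]]) (auto simp: slab_def)
  have *: "D G (torus_pt z r + n) = D G (torus_pt z r)" if n: "n = E1 \<or> n = E2" for z n
  proof -
    let ?q = "torus_pt z r"
    have q: "?q \<in> slab {a<..<b}" "?q + n \<in> V" using assms(2,4) n by (auto simp: slab_def axis_def)
    have "D G (?q + n) = D (\<lambda>q. G (q + n)) ?q"
      using smooth_on_has_derivative[OF assms(1) q(2)] differentiableI by (intro D_shift[symmetric]) blast
    also have "\<dots> = D G ?q"
    proof (rule D_cong_open[OF slab_open q(1)])
      show "G (y + n) = G y" if "y \<in> slab {a<..<b}" for y
        using assms(3) that n by (auto simp: slab_periodic_def slab_def)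
    qed simp
    finally show ?thesis .
  qed
  show "D G (torus_pt (z + e1) r) v = D G (torus_pt z r) v" "D G (torus_pt (z + e2) r) v = D G (torus_pt z r) v" for z
    using *[of E1 z] *[of E2 z] by (simp_all only: torus_pt_shift simp_thms)
qed

lemma slice_closed_form:
  assumes "smooth_on V G" "smooth_on V H" "slab {a..b} \<subseteq> V" "slab_periodic a b G" "slab_periodic a b H"
    and "\<And>q. q \<in> slab {a..b} \<Longrightarrow> D G q E2 = D H q E1" and r: "r \<in> {a..b}"
  shows "closed_torus_form (\<lambda>z. G (torus_pt z r)) (\<lambda>z. H (torus_pt z r))"
proof -
  have "slab {r} \<subseteq> V" using assms(3) r by (auto simp: slab_def)
  note D_slice = slice_D[OF assms(1) this] slice_D[OF assms(2) this]
  have pt: "torus_pt z r \<in> slab {a..b}" for z using r by (simp add: slab_def)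
  show ?thesis
    unfolding closed_torus_form_def
    by (intro conjI allI slice_torus_function[OF assms(1,3,4) r] slice_torus_function[OF assms(2,3,5) r],
        unfold D_slice torus_vec_axis) (rule assms(6)[OF pt])
qed

lemma mean_slice_derivative:
  assumes "open V" "smooth_on V G" "slab {a..b} \<subseteq> V" "r \<in> {a..b}"
  shows "((\<lambda>r. mean (\<lambda>z. G (torus_pt z r))) has_real_derivative
    mean (\<lambda>z. D G (torus_pt z r) E3)) (at r within {a..b})"
  unfolding mean_def
proof (rule leibniz_rule_field_derivative[where U = "{a..b}"
      and f = "\<lambda>r p. G (torus_pt (vector [fst p, snd p]) r)"
      and fx = "\<lambda>r p. D G (torus_pt (vector [fst p, snd p]) r) E3"])
  have inV: "torus_pt z r \<in> V" if "r \<in> {a..b}" for z r using assms(3) that by (auto simp: slab_def)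
  fix r p assume r: "r \<in> {a..b}"
  let ?z = "vector [fst p, snd p] :: real^2"
  define w where "w = fst p *\<^sub>R E1 + snd p *\<^sub>R E2"
  have eq: "torus_pt ?z s = w + s *\<^sub>R E3" for s
    by (simp add: w_def vec_eq_iff forall_3 axis_def)
  have "(G has_derivative D G (w + r *\<^sub>R E3)) (at (w + r *\<^sub>R E3))"
    using smooth_on_has_derivative[OF assms(2) inV[OF r, of ?z]] unfolding eq .
  from has_real_derivative_along_line[OF this]
  have "((\<lambda>s. G (torus_pt ?z s)) has_real_derivative D G (torus_pt ?z r) E3) (at r)"
    unfolding eq .
  then show "((\<lambda>s. G (torus_pt ?z s)) has_real_derivative D G (torus_pt ?z r) E3) (at r within {a..b})"
    by (rule has_field_derivative_at_within)
next
  have inV: "torus_pt z r \<in> V" if "r \<in> {a..b}" for z r using assms(3) that by (auto simp: slab_def)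
  show "(\<lambda>p. G (torus_pt (vector [fst p, snd p]) r)) integrable_on cbox (0, 0) (1, 1)"
    if "r \<in> {a..b}" for r
  proof -
    have "slab {r} \<subseteq> V" using that assms(3) by (auto simp: slab_def)
    from mean_integrable[OF smooth_on_continuous[OF slice_smooth[OF assms(2) this]]] show ?thesis .
  qed
  show "continuous_on ({a..b} \<times> cbox (0, 0) (1, 1))
      (\<lambda>(r, p). D G (torus_pt (vector [fst p, snd p]) r) E3)"
    unfolding split_beta
  proof (rule continuous_on_compose2[OF smooth_on_continuous[OF smooth_on_D[OF assms(2)]]])
    have "torus_pt (vector [x, y]) r = x *\<^sub>R E1 + y *\<^sub>R E2 + r *\<^sub>R E3" for x y r
      by (simp add: vec_eq_iff forall_3 axis_def)
    then show "continuous_on S (\<lambda>x. torus_pt (vector [fst (snd x), snd (snd x)]) (fst x))" for S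
      by (simp only:) (intro continuous_intros)
    show "(\<lambda>x. torus_pt (vector [fst (snd x), snd (snd x)]) (fst x)) ` ({a..b} \<times> cbox (0, 0) (1, 1)) \<subseteq> V"
      by (intro image_subsetI inV) (simp only: mem_Times_iff)
  qed
qed (use assms(4) in auto)

text \<open>\<open>P dx + Q dy + R dr\<close> stands for the contact form, \<open>B1 dx + B2 dy\<close> for the slope forms, and
  \<open>\<gamma>\<close> for the exterior derivative of the former with \<open>\<partial>\<^sub>r\<close> in its second argument. The pairing
  \<open>s * (class of P dx + Q dy) \<and> k a\<close> is positive at \<open>a\<close>, and negative at \<open>b\<close> because the slope has been
  reversed; so its derivative is negative somewhere. The derivative of the class of \<open>P dx + Q dy\<close> is
  the class of \<open>-\<gamma>\<close>. By the bilinear relation this class is a multiple of the slope class, because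
  \<open>\<gamma>\<close> is pointwise proportional to the slope form, and the factor relating the class of \<open>\<gamma>\<close> to the
  slope class has the sign of \<open>s * \<epsilon>\<close>.\<close>

lemma half_twist_direction:
  fixes P Q R B1 B2 :: "real^3 \<Rightarrow> real"
  assumes ab: "a < b" and V: "open V" "slab {a..b} \<subseteq> V"
    and sm: "smooth_on V P" "smooth_on V Q" "smooth_on V R" "smooth_on V B1" "smooth_on V B2"
    and per: "slab_periodic a b P" "slab_periodic a b Q" "slab_periodic a b R"
      "slab_periodic a b B1" "slab_periodic a b B2"
    and PQ: "\<And>q. q \<in> slab {a..b} \<Longrightarrow> D P q E2 = D Q q E1"
    and BB: "\<And>q. q \<in> slab {a..b} \<Longrightarrow> D B1 q E2 = D B2 q E1"
    and pos: "\<And>q. q \<in> slab {a..b} \<Longrightarrow> s * (P q * B2 q - Q q * B1 q) > 0"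
    and \<gamma>1: "\<And>q. \<gamma>1 q = D R q E1 - D P q E3" and \<gamma>2: "\<And>q. \<gamma>2 q = D R q E2 - D Q q E3"
    and par: "\<And>q. q \<in> slab {a..b} \<Longrightarrow> \<gamma>1 q * B2 q - \<gamma>2 q * B1 q = 0"
    and cont: "\<And>q. q \<in> slab {a..b} \<Longrightarrow> \<epsilon> * (P q * \<gamma>2 q - Q q * \<gamma>1 q) > 0"
    and k: "\<And>r. r \<in> {a..b} \<Longrightarrow> k r = sgn (Complex (mean (\<lambda>z. B1 (torus_pt z r))) (mean (\<lambda>z. B2 (torus_pt z r))))"
    and opp: "k b = - k a"
  shows "\<exists>r\<in>{a<..<b}. \<epsilon> * Im (cnj (k r) * k a) > 0"
proof -
  define m where "m G r = mean (\<lambda>z. G (torus_pt z r))" for G :: "real^3 \<Rightarrow> real" and r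
  note tf = slice_torus_function[OF _ V(2)]
  have slabr: "slab {r} \<subseteq> V" if "r \<in> {a..b}" for r using V(2) that by (auto simp: slab_def)
  have pt: "torus_pt z r \<in> slab {a..b}" if "r \<in> {a..b}" for z r using that by (simp add: slab_def)
  have clP: "closed_torus_form (\<lambda>z. P (torus_pt z r)) (\<lambda>z. Q (torus_pt z r))" if "r \<in> {a..b}" for r
    by (rule slice_closed_form[OF sm(1,2) V(2) per(1,2) PQ that])
  have clB: "closed_torus_form (\<lambda>z. B1 (torus_pt z r)) (\<lambda>z. B2 (torus_pt z r))" if "r \<in> {a..b}" for r
    by (rule slice_closed_form[OF sm(4,5) V(2) per(4,5) BB that])
  have cf: "continuous_on UNIV f" "continuous_on UNIV g" if "closed_torus_form f g" for f g
    using that by (auto simp: closed_torus_form_def torus_function_continuous)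
  have posm: "s * (m P r * m B2 r - m Q r * m B1 r) > 0" if r: "r \<in> {a..b}" for r
  proof -
    have "0 < mean (\<lambda>z. s * (P (torus_pt z r) * B2 (torus_pt z r) - Q (torus_pt z r) * B1 (torus_pt z r)))"
      using pos pt[OF r] cf[OF clP[OF r]] cf[OF clB[OF r]] by (intro mean_pos continuous_intros) auto
    then show ?thesis
      by (simp add: mean_mult riemann_bilinear[OF clP[OF r] clB[OF r]] m_def)
  qed
  have kr: "\<exists>c>0. k r = Complex (c * m B1 r) (c * m B2 r)" if r: "r \<in> {a..b}" for r
  proof -
    let ?w = "Complex (m B1 r) (m B2 r)"
    have "?w \<noteq> 0" using posm[OF r] by (auto simp: complex_eq_iff)
    then have "inverse (cmod ?w) > 0" by simp
    moreover have "k r = Complex (inverse (cmod ?w) * m B1 r) (inverse (cmod ?w) * m B2 r)"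
      unfolding k[OF r] m_def[symmetric] sgn_div_norm by (simp add: complex_eq_iff)
    ultimately show ?thesis by blast
  qed
  have pairing: "s * (m P r * Im (k r) - m Q r * Re (k r)) > 0" if r: "r \<in> {a..b}" for r
  proof -
    obtain c where "c > 0" and c: "k r = Complex (c * m B1 r) (c * m B2 r)" using kr[OF r] by blast
    have "s * (m P r * Im (k r) - m Q r * Re (k r)) = c * (s * (m P r * m B2 r - m Q r * m B1 r))"
      unfolding c by (simp add: algebra_simps)
    then show ?thesis using mult_pos_pos[OF \<open>c > 0\<close> posm[OF r]] by (simp only:)
  qed
  define J where "J r = s * (m P r * Im (k a) - m Q r * Re (k a))" for r
  define J' where "J' r = s * (m (\<lambda>q. D P q E3) r * Im (k a) - m (\<lambda>q. D Q q E3) r * Re (k a))" for r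
  have "(J has_derivative (*) (J' r)) (at r within {a..b})" if r: "a \<le> r" "r \<le> b" for r
  proof -
    have "(m G has_real_derivative m (\<lambda>q. D G q E3) r) (at r within {a..b})" if "smooth_on V G" for G
      unfolding m_def using mean_slice_derivative[OF V(1) that V(2)] r by auto
    from DERIV_cmult[OF DERIV_diff[OF DERIV_cmult_right[OF this[OF sm(1)]] DERIV_cmult_right[OF this[OF sm(2)]]]]
    show ?thesis unfolding J_def J'_def has_field_derivative_def .
  qed
  from mvt_simple[OF ab this] obtain r where r: "r \<in> {a<..<b}" and "J b - J a = J' r * (b - a)" by auto
  moreover have "J a > 0" using pairing[of a] ab by (simp add: J_def)
  moreover have "J b < 0" using pairing[of b] ab opp by (simp add: J_def algebra_simps)
  ultimately have "J' r * (b - a) < 0" by simp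
  then have J': "J' r < 0" using ab by (simp add: mult_less_0_iff)
  have r': "r \<in> {a..b}" using r by simp
  have tD: "torus_function (\<lambda>z. D G (torus_pt z r) v)" if "smooth_on V G" "slab_periodic a b G" for G v
    by (rule slice_torus_function_D[OF that(1) V(2) that(2) r])
  have cl\<gamma>: "closed_torus_form (\<lambda>z. \<gamma>1 (torus_pt z r)) (\<lambda>z. \<gamma>2 (torus_pt z r))"
    unfolding closed_torus_form_def
  proof (intro conjI allI)
    show "torus_function (\<lambda>z. \<gamma>1 (torus_pt z r))" "torus_function (\<lambda>z. \<gamma>2 (torus_pt z r))"
      unfolding \<gamma>1 \<gamma>2 by (intro torus_function_diff tD sm per)+
    fix z
    let ?q = "torus_pt z r"
    have q: "?q \<in> V" "?q \<in> slab {a<..<b}" using V(2) r by (auto simp: slab_def)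
    have D\<gamma>: "D (\<lambda>z. D G (torus_pt z r) u - D H (torus_pt z r) v) z w
        = D (\<lambda>q. D G q u) ?q (torus_vec w) - D (\<lambda>q. D H q v) ?q (torus_vec w)"
      if "smooth_on V G" "smooth_on V H" for G H :: "real^3 \<Rightarrow> real" and u v w
    proof -
      have "((\<lambda>z. D G (torus_pt z r) u - D H (torus_pt z r) v) has_derivative
          (\<lambda>w. D (\<lambda>q. D G q u) ?q (torus_vec w) - D (\<lambda>q. D H q v) ?q (torus_vec w))) (at z)"
        using that by (intro has_derivative_diff has_derivative_compose[OF torus_pt_derivative]
            smooth_on_has_derivative[OF smooth_on_D q(1)])
      from fun_cong[OF D_eqI[OF this]] show ?thesis .
    qed
    have "D (\<lambda>q. D P q E3) ?q E2 = D (\<lambda>q. D P q E2) ?q E3"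
      by (rule D_commute_real[OF V(1) sm(1) q(1)])
    also have "D (\<lambda>q. D P q E2) ?q = D (\<lambda>q. D Q q E1) ?q"
      by (rule D_cong_open[OF slab_open q(2)]) (auto intro!: PQ simp: slab_def)
    also have "D (\<lambda>q. D Q q E1) ?q E3 = D (\<lambda>q. D Q q E3) ?q E1"
      by (rule D_commute_real[OF V(1) sm(2) q(1)])
    finally show "D (\<lambda>z. \<gamma>1 (torus_pt z r)) z e2 = D (\<lambda>z. \<gamma>2 (torus_pt z r)) z e1"
      unfolding \<gamma>1 \<gamma>2 D\<gamma>[OF sm(3,1)] D\<gamma>[OF sm(3,2)] torus_vec_axis
      using D_commute_real[OF V(1) sm(3) q(1), of E1 E2] by simp
  qed
  have parallel: "m \<gamma>1 r * m B2 r - m \<gamma>2 r * m B1 r = 0"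
    using riemann_bilinear[OF cl\<gamma> clB[OF r']] par[OF pt[OF r']] by (simp add: m_def mean_const)
  have sign: "\<epsilon> * (m P r * m \<gamma>2 r - m Q r * m \<gamma>1 r) > 0"
  proof -
    have "0 < mean (\<lambda>z. \<epsilon> * (P (torus_pt z r) * \<gamma>2 (torus_pt z r) - Q (torus_pt z r) * \<gamma>1 (torus_pt z r)))"
      using cont pt[OF r'] cf[OF clP[OF r']] cf[OF cl\<gamma>] by (intro mean_pos continuous_intros) auto
    then show ?thesis
      by (simp add: mean_mult riemann_bilinear[OF clP[OF r'] cl\<gamma>] m_def)
  qed
  have m\<gamma>: "m \<gamma>1 r = - m (\<lambda>q. D P q E3) r" "m \<gamma>2 r = - m (\<lambda>q. D Q q E3) r"
  proof -
    have "mean (\<lambda>z. D R (torus_pt z r) E1) = 0" "mean (\<lambda>z. D R (torus_pt z r) E2) = 0"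
      using mean_D[OF tf[OF sm(3) per(3) r']]
      unfolding slice_D[OF sm(3) slabr[OF r']] torus_vec_axis .
    then show "m \<gamma>1 r = - m (\<lambda>q. D P q E3) r" "m \<gamma>2 r = - m (\<lambda>q. D Q q E3) r"
      unfolding m_def \<gamma>1 \<gamma>2 using tD sm per
      by (simp_all add: mean_diff torus_function_continuous)
  qed
  obtain c where c: "c > 0" "k r = Complex (c * m B1 r) (c * m B2 r)" using kr[OF r'] by blast
  have Im: "Im (cnj (k r) * k a) = c * m B1 r * Im (k a) - c * m B2 r * Re (k a)"
    unfolding c(2) by simp
  have B: "s * (m P r * m B2 r - m Q r * m B1 r) > 0" by (rule posm[OF r'])
  have J'eq: "J' r = s * (m \<gamma>2 r * Re (k a) - m \<gamma>1 r * Im (k a))"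
    unfolding J'_def m\<gamma> by (simp add: algebra_simps)
  \<comment> \<open>Since the classes of \<open>\<gamma>\<close> and of the slope form are proportional, their pairings with \<open>k a\<close> are in
    the same ratio as their pairings with the class of \<open>P dx + Q dy\<close>.\<close>
  have key: "c * (J' r * (m P r * m B2 r - m Q r * m B1 r))
      = - (s * (m P r * m \<gamma>2 r - m Q r * m \<gamma>1 r)) * Im (cnj (k r) * k a)"
    unfolding J'eq Im using parallel by algebra
  have "\<epsilon> * Im (cnj (k r) * k a) > 0"
  proof -
    let ?p = "m P r * m B2 r - m Q r * m B1 r" and ?g = "m P r * m \<gamma>2 r - m Q r * m \<gamma>1 r"
    have "(s * ?p) * (c * J' r) < 0" using B c(1) J' by (intro mult_pos_neg)
    moreover have "(s * ?p) * (c * J' r) = - (s\<^sup>2 * (?g * Im (cnj (k r) * k a)))"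
      using key by algebra
    ultimately have "s\<^sup>2 * (?g * Im (cnj (k r) * k a)) > 0" by linarith
    then have gI: "?g * Im (cnj (k r) * k a) > 0" by (rule zero_less_mult_pos) (use B in auto)
    have "\<epsilon>\<^sup>2 * (?g * Im (cnj (k r) * k a)) > 0"
      using sign by (intro mult_pos_pos gI) auto
    then have "(\<epsilon> * ?g) * (\<epsilon> * Im (cnj (k r) * k a)) > 0"
      by (simp only: power2_eq_square mult.assoc mult.left_commute)
    then show ?thesis using sign zero_less_mult_pos by blast
  qed
  with r show ?thesis by blast
qed

section \<open>Pullbacks under smooth maps of three-space\<close>

lemma det_matrix_eq_triple:
  "det (matrix L) = L E1 \<bullet> cross3 (L E2) (L E3)"
  by (simp add: det_3 matrix_def cross3_simps)

lemma bounded_bilinear_cross3: "bounded_bilinear cross3"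
  using bilinear_cross bilinear_conv_bounded_bilinear by blast

text \<open>On a three-dimensional space all alternating three-forms are multiples of the triple product,
  so each one is determined by its value on the standard basis.\<close>

lemma alternating3_det:
  assumes "alternating3 \<omega>"
  shows "\<omega> u v w = \<omega> E1 E2 E3 * (u \<bullet> cross3 v w)"
proof -
  have lin: "linear (\<lambda>w. \<omega> w u v)" "linear (\<lambda>w. \<omega> u w v)" "linear (\<lambda>w. \<omega> u v w)"
    and alt: "\<omega> u u v = 0" "\<omega> u v u = 0" "\<omega> u v v = 0" for u v
    using assms by (auto simp: alternating3_def)
  note add = lin(1)[THEN linear_add] lin(2)[THEN linear_add] lin(3)[THEN linear_add]
  note scale = lin(1)[THEN linear_scale] lin(2)[THEN linear_scale] lin(3)[THEN linear_scale]
  have swap12: "\<omega> v u w = - \<omega> u v w" for u v w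
    using alt(1)[of "u + v" w] unfolding add unfolding alt by simp
  have swap23: "\<omega> u w v = - \<omega> u v w" for u v w
    using alt(3)[of u "v + w"] unfolding add unfolding alt by simp
  have perm: "\<omega> E1 E3 E2 = - \<omega> E1 E2 E3" "\<omega> E2 E1 E3 = - \<omega> E1 E2 E3" "\<omega> E2 E3 E1 = \<omega> E1 E2 E3"
    "\<omega> E3 E1 E2 = \<omega> E1 E2 E3" "\<omega> E3 E2 E1 = - \<omega> E1 E2 E3"
    using swap12 swap23 by (metis minus_minus)+
  have "\<omega> u v w = \<omega> (u $ 1 *\<^sub>R E1 + u $ 2 *\<^sub>R E2 + u $ 3 *\<^sub>R E3)
      (v $ 1 *\<^sub>R E1 + v $ 2 *\<^sub>R E2 + v $ 3 *\<^sub>R E3) (w $ 1 *\<^sub>R E1 + w $ 2 *\<^sub>R E2 + w $ 3 *\<^sub>R E3)"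
    by (simp only: expand3[symmetric])
  also have "\<dots> = \<omega> E1 E2 E3 * (u \<bullet> cross3 v w)"
    by (simp only: add scale alt perm) (simp add: cross3_simps)
  finally show ?thesis .
qed

text \<open>The exterior derivative in one coordinate system, for forms that do not belong to a family
  indexed by charts, such as pullbacks to the slab.\<close>

definition d1 :: "(real^3 \<Rightarrow> real^3 \<Rightarrow> real) \<Rightarrow> real^3 \<Rightarrow> real^3 \<Rightarrow> real^3 \<Rightarrow> real" where
  "d1 a x u v = D (\<lambda>y. a y v) x u - D (\<lambda>y. a y u) x v"

lemma d1_cong:
  assumes "open S" "x \<in> S" "\<And>y v. y \<in> S \<Longrightarrow> a y v = b y v"
  shows "d1 a x = d1 b x"
  unfolding d1_def using D_cong_open[OF assms(1,2) assms(3)] by (simp add: fun_eq_iff)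

definition smooth_form :: "(real^3) set \<Rightarrow> (real^3 \<Rightarrow> real^3 \<Rightarrow> real) \<Rightarrow> bool" where
  "smooth_form S a \<longleftrightarrow> (\<forall>x\<in>S. linear (a x)) \<and> (\<forall>v. smooth_on S (\<lambda>x. a x v))"

text \<open>Representing a form by a vector field separates the base point from the argument, so that the
  product rule applies to expressions in which both depend on the point.\<close>

lemma smooth_form_dual:
  assumes "open S" "smooth_form S a"
  obtains A where "smooth_on S A" "\<And>x v. x \<in> S \<Longrightarrow> a x v = A x \<bullet> v"
    "\<And>x u v. x \<in> S \<Longrightarrow> d1 a x u v = D A x u \<bullet> v - D A x v \<bullet> u"
proof -
  define A where "A = (\<lambda>x. \<Sum>b\<in>Basis. a x b *\<^sub>R b)"
  have smA: "smooth_on S A"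
    unfolding A_def using assms
    by (intro smooth_on_sum smooth_on_bilinear[OF bounded_bilinear_scaleR] smooth_on_const)
      (auto simp: smooth_form_def)
  have aA: "a x v = A x \<bullet> v" if "x \<in> S" for x v
  proof -
    have lin: "linear (a x)" using that assms by (simp add: smooth_form_def)
    have "a x v = a x (\<Sum>b\<in>Basis. (v \<bullet> b) *\<^sub>R b)" by (simp only: euclidean_representation)
    also have "\<dots> = (\<Sum>b\<in>Basis. (v \<bullet> b) * a x b)"
      by (simp add: linear_sum[OF lin] linear_scale[OF lin])
    also have "\<dots> = A x \<bullet> v"
      by (simp add: A_def inner_sum_left inner_commute[of v] mult.commute)
    finally show ?thesis .
  qed
  have Da: "D (\<lambda>y. a y v) x u = D A x u \<bullet> v" if x: "x \<in> S" for x u v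
  proof -
    have "D (\<lambda>y. a y v) x = D (\<lambda>y. A y \<bullet> v) x"
      by (rule D_cong_open[OF assms(1) x]) (rule aA)
    also have "\<dots> = (\<lambda>u. D A x u \<bullet> v)"
      by (rule D_eqI[OF has_derivative_inner_left[OF smooth_on_has_derivative[OF smA x]]])
    finally show ?thesis by (rule fun_cong)
  qed
  show thesis
    by (rule that[OF smA aA]) (simp_all add: d1_def Da)
qed

lemma d1_bilinear:
  assumes "open S" "smooth_form S a" "x \<in> S"
  shows "linear (\<lambda>u. d1 a x u v)" "linear (\<lambda>v. d1 a x u v)"
proof -
  obtain A where A: "smooth_on S A" "\<And>u v. d1 a x u v = D A x u \<bullet> v - D A x v \<bullet> u"
    using smooth_form_dual[OF assms(1,2)] assms(3) by metis
  have lin: "linear (D A x)"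
    using smooth_on_has_derivative[OF A(1) assms(3)] has_derivative_linear by blast
  show "linear (\<lambda>u. d1 a x u v)" "linear (\<lambda>v. d1 a x u v)"
    unfolding A(2)
    by (auto intro!: linearI simp: linear_add[OF lin] linear_scale[OF lin] inner_add_left
        inner_add_right algebra_simps)
qed

lemma d1_skew: "d1 a x u v = - d1 a x v u"
  by (simp add: d1_def)

definition pullback1 :: "(real^3 \<Rightarrow> real^3) \<Rightarrow> (real^3 \<Rightarrow> real^3 \<Rightarrow> real) \<Rightarrow> real^3 \<Rightarrow> real^3 \<Rightarrow> real" where
  "pullback1 \<psi> a q v = a (\<psi> q) (D \<psi> q v)"

lemma smooth_on_linear_D:
  assumes "smooth_on N \<psi>" "q \<in> N"
  shows "linear (D \<psi> q)"
  using smooth_on_has_derivative[OF assms] has_derivative_linear by blast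

lemma pullback1_smooth:
  assumes N: "open N" "smooth_on N \<psi>" and S: "open S" "\<psi> ` N \<subseteq> S" and a: "smooth_form S a"
  shows "smooth_form N (pullback1 \<psi> a)"
proof -
  obtain A where A: "smooth_on S A" "\<And>x v. x \<in> S \<Longrightarrow> a x v = A x \<bullet> v"
    using smooth_form_dual[OF S(1) a] by metis
  have "smooth_on N (\<lambda>q. pullback1 \<psi> a q v)" for v
  proof (rule smooth_on_cong[OF N(1)])
    show "A (\<psi> q) \<bullet> D \<psi> q v = pullback1 \<psi> a q v" if "q \<in> N" for q
      using A(2) that S(2) by (auto simp: pullback1_def)
    show "smooth_on N (\<lambda>q. A (\<psi> q) \<bullet> D \<psi> q v)"
      by (intro smooth_on_bilinear[OF bounded_bilinear_inner] smooth_on_compose[OF N A(1) S(2)]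
          smooth_on_D N)
  qed
  moreover have "linear (pullback1 \<psi> a q)" if "q \<in> N" for q
  proof -
    have "linear (a (\<psi> q))" using a S(2) that by (auto simp: smooth_form_def)
    from linear_compose[OF smooth_on_linear_D[OF N(2) that] this]
    show ?thesis by (simp add: o_def pullback1_def[abs_def])
  qed
  ultimately show ?thesis by (simp add: smooth_form_def)
qed

text \<open>Exterior differentiation commutes with pullback: the terms containing second derivatives of
  \<open>\<psi>\<close> cancel by symmetry.\<close>

lemma d1_pullback1:
  assumes N: "open N" "smooth_on N \<psi>" and S: "open S" "\<psi> ` N \<subseteq> S" and a: "smooth_form S a"
    and q: "q \<in> N"
  shows "d1 (pullback1 \<psi> a) q u v = d1 a (\<psi> q) (D \<psi> q u) (D \<psi> q v)"
proof -
  obtain A where A: "smooth_on S A" "\<And>x v. x \<in> S \<Longrightarrow> a x v = A x \<bullet> v"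
    "\<And>x u v. x \<in> S \<Longrightarrow> d1 a x u v = D A x u \<bullet> v - D A x v \<bullet> u"
    using smooth_form_dual[OF S(1) a] by metis
  have \<psi>q: "\<psi> q \<in> S" using S(2) q by auto
  have "D (\<lambda>q. pullback1 \<psi> a q v) q u
      = A (\<psi> q) \<bullet> D (\<lambda>q. D \<psi> q v) q u + D A (\<psi> q) (D \<psi> q u) \<bullet> D \<psi> q v" for u v
  proof -
    have "D (\<lambda>q. pullback1 \<psi> a q v) q = D (\<lambda>q. A (\<psi> q) \<bullet> D \<psi> q v) q"
      using A(2) S(2) by (intro D_cong_open[OF N(1) q]) (auto simp: pullback1_def)
    also have "\<dots> = (\<lambda>u. A (\<psi> q) \<bullet> D (\<lambda>q. D \<psi> q v) q u + D A (\<psi> q) (D \<psi> q u) \<bullet> D \<psi> q v)"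
      by (intro D_eqI has_derivative_inner has_derivative_compose[OF smooth_on_has_derivative[OF N(2) q]]
          smooth_on_has_derivative[OF A(1) \<psi>q] smooth_on_has_derivative[OF smooth_on_D[OF N(2)] q])
    finally show ?thesis by (rule fun_cong)
  qed
  then show ?thesis
    unfolding d1_def[of "pullback1 \<psi> a"] A(3)[OF \<psi>q]
    using D_commute[OF N(1,2) q, of u v] by simp
qed

text \<open>The flux of a vector field \<open>n\<close> through the surface elements spanned by the images of two
  vectors, that is, the pullback of the two-form with components \<open>n\<close>.\<close>

definition flux :: "(real^3 \<Rightarrow> real^3) \<Rightarrow> (real^3 \<Rightarrow> real^3) \<Rightarrow> real^3 \<Rightarrow> real^3 \<Rightarrow> real^3 \<Rightarrow> real" where
  "flux \<psi> n q v w = n (\<psi> q) \<bullet> cross3 (D \<psi> q v) (D \<psi> q w)"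

lemma flux_smooth:
  assumes N: "open N" "smooth_on N \<psi>" and n: "smooth_on S n" "\<psi> ` N \<subseteq> S"
  shows "smooth_on N (\<lambda>q. flux \<psi> n q v w)"
  unfolding flux_def
  by (intro smooth_on_bilinear[OF bounded_bilinear_inner] smooth_on_bilinear[OF bounded_bilinear_cross3]
      smooth_on_compose[OF N n] smooth_on_D N)

text \<open>The infinitesimal form of the multiplicativity of the determinant: the trace is the rate at which
  a linear vector field changes volumes.\<close>

lemma trace_cross:
  fixes T :: "real^3 \<Rightarrow> real^3"
  assumes "linear T"
  shows "T a \<bullet> cross3 b c + T b \<bullet> cross3 c a + T c \<bullet> cross3 a b
    = (T E1 $ 1 + T E2 $ 2 + T E3 $ 3) * (a \<bullet> cross3 b c)"
proof -
  have T: "T v = v $ 1 *\<^sub>R T E1 + v $ 2 *\<^sub>R T E2 + v $ 3 *\<^sub>R T E3" for v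
    using arg_cong[OF expand3[of v], of T] by (simp only: linear_add[OF assms] linear_scale[OF assms])
  define t where "t i = T (axis i 1)" for i
  have "T v $ i = v $ 1 * t 1 $ i + v $ 2 * t 2 $ i + v $ 3 * t 3 $ i" for v i
    unfolding t_def by (subst T) simp
  then show ?thesis
    unfolding t_def[symmetric] by (simp add: cross3_simps)
qed

text \<open>A divergence-free vector field pulls back to a closed two-form. The terms containing the
  derivative of \<open>n\<close> add up to a multiple of the divergence, and those containing second derivatives
  of \<open>\<psi>\<close> cancel by symmetry.\<close>

lemma flux_closed:
  assumes N: "open N" "smooth_on N \<psi>" and n: "smooth_on S n" "\<psi> ` N \<subseteq> S" and q: "q \<in> N"
    and div: "D n (\<psi> q) E1 $ 1 + D n (\<psi> q) E2 $ 2 + D n (\<psi> q) E3 $ 3 = 0"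
  shows "D (\<lambda>q. flux \<psi> n q E2 E3) q E1 + D (\<lambda>q. flux \<psi> n q E3 E1) q E2
    + D (\<lambda>q. flux \<psi> n q E1 E2) q E3 = 0"
proof -
  have \<psi>q: "\<psi> q \<in> S" using n(2) q by auto
  let ?L = "D \<psi> q" and ?T = "D n (\<psi> q)" and ?H = "\<lambda>v u. D (\<lambda>q. D \<psi> q v) q u"
  have Df: "D (\<lambda>q. flux \<psi> n q v w) q u = n (\<psi> q) \<bullet> (cross3 (?L v) (?H w u) + cross3 (?H v u) (?L w))
      + ?T (?L u) \<bullet> cross3 (?L v) (?L w)" for u v w
    unfolding flux_def
    by (rule fun_cong[OF D_eqI[OF has_derivative_inner[OF
          has_derivative_compose[OF smooth_on_has_derivative[OF N(2) q] smooth_on_has_derivative[OF n(1) \<psi>q]]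
          bounded_bilinear.FDERIV[OF bounded_bilinear_cross3
            smooth_on_has_derivative[OF smooth_on_D[OF N(2)] q] smooth_on_has_derivative[OF smooth_on_D[OF N(2)] q]]]]])
  have sym: "?H E2 E1 = ?H E1 E2" "?H E3 E1 = ?H E1 E3" "?H E3 E2 = ?H E2 E3"
    by (rule D_commute[OF N q])+
  have lin: "linear ?T" using smooth_on_has_derivative[OF n(1) \<psi>q] has_derivative_linear by blast
  have skew: "cross3 (?H v w) (?L u) = - cross3 (?L u) (?H v w)" for u v w by (rule cross_skew)
  have "?T (?L E1) \<bullet> cross3 (?L E2) (?L E3) + ?T (?L E2) \<bullet> cross3 (?L E3) (?L E1)
      + ?T (?L E3) \<bullet> cross3 (?L E1) (?L E2) = 0"
    using trace_cross[OF lin, of "?L E1" "?L E2" "?L E3"] div by simp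
  then show ?thesis
    unfolding Df sym skew inner_add_right inner_minus_right by linarith
qed

section \<open>Orientations and signs of densities\<close>

locale oriented_manifold =
  fixes M :: "'a topology" and A :: "'a chart set"
  assumes manifold: "oriented_3manifold M A"
begin

lemma chart_domain: "c \<in> A \<Longrightarrow> openin M (fst c)"
  and chart_image_open: "c \<in> A \<Longrightarrow> open (chart_image c)"
  and chart_homeo: "c \<in> A \<Longrightarrow> homeomorphic_map (subtopology M (fst c)) (top_of_set (chart_image c)) (snd c)"
  and charts_cover: "(\<Union>c\<in>A. fst c) = topspace M"
  using manifold by (auto simp: oriented_3manifold_def oriented_atlas_def chart_on_def)

lemma transition_smooth: "c \<in> A \<Longrightarrow> d \<in> A \<Longrightarrow> smooth_on (overlap c d) (transition c d)"
  and transition_det: "c \<in> A \<Longrightarrow> d \<in> A \<Longrightarrow> x \<in> overlap c d \<Longrightarrow> det (matrix (D (transition c d) x)) > 0"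
  using manifold unfolding oriented_3manifold_def oriented_atlas_def by blast+

lemma chart_inj:
  assumes "c \<in> A"
  shows "inj_on (snd c) (fst c)"
  using homeomorphic_imp_injective_map[OF chart_homeo[OF assms]] openin_subset[OF chart_domain[OF assms]]
  by (simp add: Int_absorb1)

lemma transition_apply:
  assumes "c \<in> A" "p \<in> fst c"
  shows "transition c d (snd c p) = snd d p"
  using inv_into_f_f[OF chart_inj[OF assms(1)] assms(2)] by (simp add: transition_def)

lemma transition_image: "c \<in> A \<Longrightarrow> transition c d ` overlap c d \<subseteq> chart_image d"
  by (auto simp: transition_apply)

lemma overlap_open:
  assumes "c \<in> A" "d \<in> A"
  shows "open (overlap c d)"
proof -
  have "openin (subtopology M (fst c)) (fst c \<inter> fst d)"
    using chart_domain assms by (simp add: openin_open_subtopology openin_Int)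
  then have "openin (top_of_set (chart_image c)) (overlap c d)"
    using homeomorphic_imp_open_map[OF chart_homeo[OF assms(1)]] unfolding open_map_def by blast
  then show ?thesis using openin_open_trans chart_image_open[OF assms(1)] by blast
qed

text \<open>A nowhere zero density has a sign on a connected oriented manifold, because charts are related
  by transition maps of positive determinant.\<close>

lemma density_sign:
  fixes g :: "'a chart \<Rightarrow> real^3 \<Rightarrow> real"
  assumes conn: "connected_space M"
    and cont: "\<And>c. c \<in> A \<Longrightarrow> continuous_on (chart_image c) (g c)"
    and nz: "\<And>c x. c \<in> A \<Longrightarrow> x \<in> chart_image c \<Longrightarrow> g c x \<noteq> 0"
    and tr: "\<And>c d x. c \<in> A \<Longrightarrow> d \<in> A \<Longrightarrow> x \<in> overlap c d \<Longrightarrow>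
      g c x = g d (transition c d x) * det (matrix (D (transition c d) x))"
  obtains s :: real where "\<And>c x. c \<in> A \<Longrightarrow> x \<in> chart_image c \<Longrightarrow> s * g c x > 0"
proof -
  define W where "W s c = {p \<in> fst c. s * g c (snd c p) > 0}" for s :: real and c
  define U where "U s = (\<Union>c\<in>A. W s c)" for s
  have W: "openin M (W s c)" if c: "c \<in> A" for s c
  proof -
    have sub: "fst c \<subseteq> topspace M" using openin_subset[OF chart_domain[OF c]] .
    have "continuous_map (top_of_set (chart_image c)) euclideanreal (\<lambda>x. s * g c x)"
      using cont[OF c] by (simp add: continuous_on_mult_left)
    from continuous_map_compose[OF homeomorphic_imp_continuous_map[OF chart_homeo[OF c]] this]
    have "continuous_map (subtopology M (fst c)) euclideanreal ((\<lambda>x. s * g c x) \<circ> snd c)" .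
    from openin_continuous_map_preimage[OF this, of "{0<..}"]
    have "openin (subtopology M (fst c)) (W s c)"
      using sub by (simp add: W_def Int_absorb1)
    then show ?thesis using openin_trans_full chart_domain[OF c] by blast
  qed
  have op: "openin M (U s)" for s unfolding U_def using W by blast
  have indep: "s * g d (snd d p) > 0" if "c \<in> A" "d \<in> A" "p \<in> fst c" "p \<in> fst d" "s * g c (snd c p) > 0"
    for s c d p
  proof -
    have x: "snd c p \<in> overlap c d" using that by auto
    have "s * g c (snd c p) = (s * g d (snd d p)) * det (matrix (D (transition c d) (snd c p)))"
      using tr[OF that(1,2) x] transition_apply[OF that(1,3)] by simp
    then show ?thesis using that(5) transition_det[OF that(1,2) x] by (metis zero_less_mult_pos2)
  qed
  have cover: "topspace M \<subseteq> U 1 \<union> U (-1)"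
  proof
    fix p assume "p \<in> topspace M"
    then obtain c where c: "c \<in> A" "p \<in> fst c" using charts_cover by blast
    then have "g c (snd c p) \<noteq> 0" using nz by auto
    then have "p \<in> W 1 c \<or> p \<in> W (-1) c" using c(2) unfolding W_def by auto
    then show "p \<in> U 1 \<union> U (-1)" using c unfolding U_def by blast
  qed
  have disj: "U 1 \<inter> U (-1) = {}"
  proof (rule ccontr)
    assume "U 1 \<inter> U (-1) \<noteq> {}"
    then obtain p c d where "c \<in> A" "d \<in> A" "p \<in> W 1 c" "p \<in> W (-1) d" unfolding U_def by blast
    then show False using indep[of c d p 1] unfolding W_def by auto
  qed
  have sign: "- s * g c x > 0" if s: "s \<noteq> 0" "U s = {}" and c: "c \<in> A" "x \<in> chart_image c" for s c x
  proof -
    obtain p where p: "p \<in> fst c" "x = snd c p" using c(2) by blast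
    have "\<not> s * g c x > 0" using s(2) c(1) p unfolding U_def W_def by blast
    moreover have "s * g c x \<noteq> 0" using nz[OF c] s(1) by simp
    ultimately show ?thesis by linarith
  qed
  have "U 1 = {} \<or> U (-1) = {}"
    using conn op cover disj unfolding connected_space_def by blast
  then show thesis using that[of "- 1"] that[of "1"] sign[of 1] sign[of "-1"] by auto
qed

lemma one_form_smooth_form: "one_form A \<alpha> \<Longrightarrow> c \<in> A \<Longrightarrow> smooth_form (chart_image c) (\<alpha> c)"
  by (simp add: one_form_def smooth_form_def)

lemma one_form_transition:
  assumes \<alpha>: "one_form A \<alpha>" and c: "c \<in> A" and d: "d \<in> A" and x: "x \<in> overlap c d"
  shows "\<alpha> c x v = \<alpha> d (transition c d x) (D (transition c d) x v)"
  using bspec[OF bspec[OF bspec[OF conjunct2[OF \<alpha>[unfolded one_form_def]] c] d] x] by (rule spec)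

lemma three_form_transition:
  assumes \<omega>: "three_form A \<omega>" and c: "c \<in> A" and d: "d \<in> A" and x: "x \<in> overlap c d"
  shows "\<omega> c x u v w = \<omega> d (transition c d x)
    (D (transition c d) x u) (D (transition c d) x v) (D (transition c d) x w)"
  using bspec[OF bspec[OF bspec[OF conjunct2[OF \<omega>[unfolded three_form_def]] c] d] x, rule_format] .

lemma vector_field_transition:
  assumes X: "vector_field A X" and c: "c \<in> A" and d: "d \<in> A" and x: "x \<in> overlap c d"
  shows "X d (transition c d x) = D (transition c d) x (X c x)"
  by (rule bspec[OF bspec[OF bspec[OF conjunct2[OF X[unfolded vector_field_def]] c] d] x])

lemma ext_deriv_eq_d1: "ext_deriv \<alpha> c = d1 (\<alpha> c)"
  by (simp add: fun_eq_iff ext_deriv_def d1_def)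

lemma ext_deriv_transition:
  assumes \<alpha>: "one_form A \<alpha>" and c: "c \<in> A" "d \<in> A" "x \<in> overlap c d"
  shows "ext_deriv \<alpha> c x u v = ext_deriv \<alpha> d (transition c d x) (D (transition c d) x u) (D (transition c d) x v)"
proof -
  have "d1 (\<alpha> c) x = d1 (pullback1 (transition c d) (\<alpha> d)) x"
  proof (rule d1_cong[OF overlap_open[OF c(1,2)] c(3)])
    show "\<alpha> c y v = pullback1 (transition c d) (\<alpha> d) y v" if "y \<in> overlap c d" for y v
      unfolding pullback1_def by (rule one_form_transition[OF \<alpha> c(1,2) that])
  qed
  then show ?thesis
    using d1_pullback1[OF overlap_open[OF c(1,2)] transition_smooth[OF c(1,2)] chart_image_open[OF c(2)]
        transition_image[OF c(1)] one_form_smooth_form[OF \<alpha> c(2)] c(3)]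
    by (simp only: ext_deriv_eq_d1)
qed

lemma wedge_alternating:
  assumes \<alpha>: "one_form A \<alpha>" and c: "c \<in> A" "x \<in> chart_image c"
  shows "alternating3 (wedge \<alpha> (ext_deriv \<alpha>) c x)"
proof -
  have a: "linear (\<alpha> c x)" using \<alpha> c by (auto simp: one_form_def)
  note lin = d1_bilinear[OF chart_image_open[OF c(1)] one_form_smooth_form[OF \<alpha> c(1)] c(2)]
  note add = linear_add[OF a] lin(1)[THEN linear_add] lin(2)[THEN linear_add]
  note scale = linear_scale[OF a] lin(1)[THEN linear_scale] lin(2)[THEN linear_scale]
  show ?thesis
    unfolding alternating3_def wedge_def ext_deriv_eq_d1
  proof (intro conjI allI)
    fix u v
    show "linear (\<lambda>w. \<alpha> c x w * d1 (\<alpha> c) x u v + \<alpha> c x u * d1 (\<alpha> c) x v w + \<alpha> c x v * d1 (\<alpha> c) x w u)"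
      "linear (\<lambda>w. \<alpha> c x u * d1 (\<alpha> c) x w v + \<alpha> c x w * d1 (\<alpha> c) x v u + \<alpha> c x v * d1 (\<alpha> c) x u w)"
      "linear (\<lambda>w. \<alpha> c x u * d1 (\<alpha> c) x v w + \<alpha> c x v * d1 (\<alpha> c) x w u + \<alpha> c x w * d1 (\<alpha> c) x u v)"
      by (intro linearI; simp add: add scale algebra_simps)+
  qed (simp_all add: d1_def algebra_simps)
qed

lemma contact_form_sign:
  assumes "connected_space M" and ct: "contact_form A \<alpha>"
  obtains \<epsilon> :: real where "\<And>c x. c \<in> A \<Longrightarrow> x \<in> chart_image c \<Longrightarrow>
    \<epsilon> * wedge \<alpha> (ext_deriv \<alpha>) c x E1 E2 E3 > 0"
proof (rule density_sign[of "\<lambda>c x. wedge \<alpha> (ext_deriv \<alpha>) c x E1 E2 E3"])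
  have \<alpha>: "one_form A \<alpha>" using ct by (simp add: contact_form_def)
  note det = alternating3_det[OF wedge_alternating[OF \<alpha>]]
  fix c assume c: "c \<in> A"
  have sm: "smooth_on (chart_image c) (\<lambda>x. \<alpha> c x v)" for v using \<alpha> c by (simp add: one_form_def)
  show "continuous_on (chart_image c) (\<lambda>x. wedge \<alpha> (ext_deriv \<alpha>) c x E1 E2 E3)"
    unfolding wedge_def ext_deriv_def
    by (intro continuous_intros smooth_on_continuous smooth_on_D sm)
  {
    fix x assume x: "x \<in> chart_image c"
    have "wedge \<alpha> (ext_deriv \<alpha>) c x \<noteq> (\<lambda>u v w. 0)" using ct c x by (auto simp: contact_form_def)
    moreover have "wedge \<alpha> (ext_deriv \<alpha>) c x = (\<lambda>u v w. 0)"
      if "wedge \<alpha> (ext_deriv \<alpha>) c x E1 E2 E3 = 0"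
      by (intro ext) (subst det[OF c x], simp only: that mult_zero_left)
    ultimately show "wedge \<alpha> (ext_deriv \<alpha>) c x E1 E2 E3 \<noteq> 0" by blast
  }
  fix d x assume d: "d \<in> A" and x: "x \<in> overlap c d"
  have y: "transition c d x \<in> chart_image d" using transition_image[OF c] x by blast
  have "\<alpha> c x v = \<alpha> d (transition c d x) (D (transition c d) x v)" for v
    by (rule one_form_transition[OF \<alpha> c d x])
  then have "wedge \<alpha> (ext_deriv \<alpha>) c x E1 E2 E3 = wedge \<alpha> (ext_deriv \<alpha>) d (transition c d x)
      (D (transition c d) x E1) (D (transition c d) x E2) (D (transition c d) x E3)"
    unfolding wedge_def ext_deriv_transition[OF \<alpha> c d x] by (simp only:)
  then show "wedge \<alpha> (ext_deriv \<alpha>) c x E1 E2 E3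
      = wedge \<alpha> (ext_deriv \<alpha>) d (transition c d x) E1 E2 E3 * det (matrix (D (transition c d) x))"
    unfolding det[OF d y, of "D (transition c d) x E1"] det_matrix_eq_triple .
qed (use assms that in auto)

lemma volume_form_sign:
  assumes "connected_space M" and vol: "volume_form A \<mu>"
  obtains s :: real where "\<And>c x. c \<in> A \<Longrightarrow> x \<in> chart_image c \<Longrightarrow> s * \<mu> c x E1 E2 E3 > 0"
proof (rule density_sign[of "\<lambda>c x. \<mu> c x E1 E2 E3"])
  have three: "three_form A \<mu>" using vol by (simp add: volume_form_def)
  have alt: "alternating3 (\<mu> c x)" if "c \<in> A" "x \<in> chart_image c" for c x
    using three that by (auto simp: three_form_def)
  note det = alternating3_det[OF alt]
  fix c assume c: "c \<in> A"
  show "continuous_on (chart_image c) (\<lambda>x. \<mu> c x E1 E2 E3)"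
    using three c by (intro smooth_on_continuous) (simp add: three_form_def)
  {
    fix x assume x: "x \<in> chart_image c"
    have "\<mu> c x \<noteq> (\<lambda>u v w. 0)" using vol c x by (auto simp: volume_form_def)
    moreover have "\<mu> c x = (\<lambda>u v w. 0)" if "\<mu> c x E1 E2 E3 = 0"
      by (intro ext) (subst det[OF c x], simp only: that mult_zero_left)
    ultimately show "\<mu> c x E1 E2 E3 \<noteq> 0" by blast
  }
  fix d x assume d: "d \<in> A" and x: "x \<in> overlap c d"
  have y: "transition c d x \<in> chart_image d" using transition_image[OF c] x by blast
  have "\<mu> c x E1 E2 E3 = \<mu> d (transition c d x)
      (D (transition c d) x E1) (D (transition c d) x E2) (D (transition c d) x E3)"
    by (rule three_form_transition[OF three c d x])
  then show "\<mu> c x E1 E2 E3 = \<mu> d (transition c d x) E1 E2 E3 * det (matrix (D (transition c d) x))"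
    unfolding det[OF d y, of "D (transition c d) x E1"] det_matrix_eq_triple .
qed (use assms that in auto)

end

section \<open>Integrable regions in coordinates\<close>

text \<open>A derivative on a closed slab is determined by the values on the slab, also at the two
  boundary tori.\<close>

lemma slab_derivative_unique:
  assumes ab: "a < b" and q: "q \<in> slab {a..b}" and W: "open W" "q \<in> W"
    and f: "(f has_derivative f') (at q)" and g: "(g has_derivative g') (at q)"
    and eq: "\<And>p. p \<in> W \<Longrightarrow> p \<in> slab {a..b} \<Longrightarrow> f p = g p"
  shows "f' = g'"
proof (rule frechet_derivative_unique_within)
  let ?S = "W \<inter> slab {a..b}"
  show "(f has_derivative f') (at q within ?S)" using f by (rule has_derivative_at_withinI)
  show "(f has_derivative g') (at q within ?S)"
    by (rule has_derivative_transform[OF _ _ has_derivative_at_withinI[OF g]]) (use q W eq in auto)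
  fix i :: "real^3" and e :: real
  assume i: "i \<in> Basis" and e: "e > 0"
  obtain d where d: "d > 0" "ball q d \<subseteq> W" using W open_contains_ball by blast
  have q3: "a \<le> q $ 3" "q $ 3 \<le> b" using q by (auto simp: slab_def)
  have i3: "i $ 3 = 0 \<or> i $ 3 = 1" and ni: "norm i = 1"
    using i by (auto simp: Basis_vec_def axis_def)
  have *: "q + t *\<^sub>R i \<in> ?S" if "\<bar>t\<bar> < d" "a \<le> q $ 3 + t" "q $ 3 + t \<le> b" for t
  proof -
    have "q + t *\<^sub>R i \<in> ball q d" using that ni by (simp add: dist_norm)
    moreover have "q + t *\<^sub>R i \<in> slab {a..b}" using i3 that q3 by (auto simp: slab_def)
    ultimately show ?thesis using d(2) by blast
  qed
  show "\<exists>t. 0 < \<bar>t\<bar> \<and> \<bar>t\<bar> < e \<and> q + t *\<^sub>R i \<in> ?S"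
  proof (cases "q $ 3 < b")
    case True
    define t where "t = min (b - q $ 3) (min (e / 2) (d / 2))"
    have t: "0 < t" "t < e" "t < d" "t \<le> b - q $ 3" using True e d(1) by (auto simp: t_def)
    then have "q + t *\<^sub>R i \<in> ?S" using q3 by (intro *) auto
    with t show ?thesis by (intro exI[of _ t]) simp
  next
    case False
    define t where "t = min (b - a) (min (e / 2) (d / 2))"
    have t: "0 < t" "t < e" "t < d" "t \<le> b - a" using ab e d(1) by (auto simp: t_def)
    then have "q + (- t) *\<^sub>R i \<in> ?S" using q3 False by (intro *) auto
    with t show ?thesis by (intro exI[of _ "- t"]) simp
  qed
qed

text \<open>In a chart write \<open>\<mu> = m dx dy dz\<close>. The Lie derivative of \<open>\<mu>\<close> along \<open>X\<close>, evaluated on the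
  coordinate frame, is the divergence of \<open>m X\<close>, and \<open>m X\<close> is the vector field whose flux is the
  contraction of \<open>\<mu>\<close> with \<open>X\<close>.\<close>

lemma divergence_free:
  assumes X: "vector_field A X" and \<mu>: "three_form A \<mu>" "preserves A X \<mu>"
    and c: "c \<in> A" and op: "open (chart_image c)"
  defines "n \<equiv> \<lambda>y. \<mu> c y E1 E2 E3 *\<^sub>R X c y"
  shows "smooth_on (chart_image c) n" "y \<in> chart_image c \<Longrightarrow> D n y E1 $ 1 + D n y E2 $ 2 + D n y E3 $ 3 = 0"
proof -
  have smX: "smooth_on (chart_image c) (X c)" using X c by (simp add: vector_field_def)
  have smm: "smooth_on (chart_image c) (\<lambda>y. \<mu> c y E1 E2 E3)" using \<mu>(1) c by (simp add: three_form_def)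
  show "smooth_on (chart_image c) n"
    unfolding n_def by (rule smooth_on_bilinear[OF bounded_bilinear_scaleR op smm smX])
  assume y: "y \<in> chart_image c"
  let ?m = "\<mu> c y E1 E2 E3" and ?m' = "D (\<lambda>y. \<mu> c y E1 E2 E3) y" and ?X' = "D (X c) y"
  have alt: "alternating3 (\<mu> c y)" using \<mu>(1) c y by (auto simp: three_form_def)
  have m': "(( \<lambda>y. \<mu> c y E1 E2 E3) has_derivative ?m') (at y)"
    by (rule smooth_on_has_derivative[OF smm y])
  have Dn: "D n y u = ?m *\<^sub>R ?X' u + ?m' u *\<^sub>R X c y" for u
    unfolding n_def
    by (rule fun_cong[OF D_eqI[OF has_derivative_scaleR[OF m' smooth_on_has_derivative[OF smX y]]]])
  have lin: "linear ?m'" using m' by (rule has_derivative_linear)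
  have m'X: "?m' (X c y) = X c y $ 1 * ?m' E1 + X c y $ 2 * ?m' E2 + X c y $ 3 * ?m' E3"
    using arg_cong[OF expand3[of "X c y"], of ?m']
    by (simp add: linear_add[OF lin] linear_scale[OF lin])
  have lie: "Lie_deriv X \<mu> c y E1 E2 E3 = 0"
    using \<mu>(2) c y unfolding preserves_def by (auto dest!: bspec)
  have triple: "T \<bullet> cross3 E2 E3 = T $ 1" "E1 \<bullet> cross3 T E3 = T $ 2" "E1 \<bullet> cross3 E2 T = T $ 3" for T
    by (simp_all add: cross3_simps axis_def)
  have "\<mu> c y (?X' E1) E2 E3 = ?m * ?X' E1 $ 1" "\<mu> c y E1 (?X' E2) E3 = ?m * ?X' E2 $ 2"
    "\<mu> c y E1 E2 (?X' E3) = ?m * ?X' E3 $ 3"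
    using alternating3_det[OF alt, of "?X' E1" E2 E3] alternating3_det[OF alt, of E1 "?X' E2" E3]
      alternating3_det[OF alt, of E1 E2 "?X' E3"] by (simp_all only: triple)
  then show "D n y E1 $ 1 + D n y E2 $ 2 + D n y E3 $ 3 = 0"
    using lie unfolding Dn Lie_deriv_def m'X by (simp add: algebra_simps)
qed

text \<open>\<open>V\<close> is the domain of a smooth extension of \<open>F\<close>, and \<open>{a..b}\<close> the part of \<open>I\<close> on which twisting
  is studied. Outside \<open>slab I\<close> the extension may be singular.\<close>

locale torus_region = oriented_manifold M A for M :: "'a topology" and A :: "'a chart set" +
  fixes I :: "real set" and F :: "real^3 \<Rightarrow> 'a" and V :: "(real^3) set" and a b :: real
  assumes F_smooth: "smooth_into M A V F" and slab_I: "slab I \<subseteq> V"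
    and F_eq: "\<And>p q. p \<in> slab I \<Longrightarrow> q \<in> slab I \<Longrightarrow>
      F p = F q \<longleftrightarrow> p $ 1 - q $ 1 \<in> \<int> \<and> p $ 2 - q $ 2 \<in> \<int> \<and> p $ 3 = q $ 3"
    and F_det: "\<And>q c. q \<in> slab I \<Longrightarrow> c \<in> A \<Longrightarrow> F q \<in> fst c \<Longrightarrow> det (matrix (D (snd c \<circ> F) q)) > 0"
    and ab: "a < b" "{a..b} \<subseteq> I"
begin

abbreviation rep :: "'a chart \<Rightarrow> real^3 \<Rightarrow> real^3" where "rep c \<equiv> snd c \<circ> F"

definition patch :: "'a chart \<Rightarrow> (real^3) set" where "patch c = {q \<in> V. F q \<in> fst c}"

lemma V_open: "open V"
  using F_smooth by (simp add: smooth_into_def)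

lemma slab_ab: "slab {a..b} \<subseteq> slab I" "slab {a..b} \<subseteq> V"
  using ab(2) slab_I by (auto simp: slab_def)

lemma patch_open:
  assumes "c \<in> A"
  shows "open (patch c)"
proof -
  have F: "continuous_map (top_of_set V) M F" using F_smooth by (simp add: smooth_into_def)
  have "openin (top_of_set V) (patch c)"
    using openin_continuous_map_preimage[OF F chart_domain[OF assms]] by (simp add: patch_def)
  then show ?thesis using openin_open_trans V_open by blast
qed

lemma patch_cover:
  assumes "q \<in> V"
  obtains c where "c \<in> A" "q \<in> patch c"
proof -
  have "F q \<in> topspace M"
    using F_smooth assms by (auto simp: smooth_into_def continuous_map_def)
  then obtain c where "c \<in> A" "F q \<in> fst c" using charts_cover by blast
  then show thesis using that assms by (auto simp: patch_def)
qed

lemma rep_smooth: "c \<in> A \<Longrightarrow> smooth_on (patch c) (rep c)"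
  using F_smooth by (simp add: smooth_into_def patch_def)

lemma rep_in: "q \<in> patch c \<Longrightarrow> rep c q \<in> chart_image c"
  by (auto simp: patch_def)

lemma rep_image: "rep c ` patch c \<subseteq> chart_image c"
  using rep_in by blast

lemma rep_overlap: "q \<in> patch c \<Longrightarrow> q \<in> patch d \<Longrightarrow> rep c q \<in> overlap c d"
  by (auto simp: patch_def)

lemma rep_transition: "c \<in> A \<Longrightarrow> q \<in> patch c \<Longrightarrow> transition c d (rep c q) = rep d q"
  by (simp add: patch_def transition_apply)

lemma rep_derivative: "c \<in> A \<Longrightarrow> q \<in> patch c \<Longrightarrow> (rep c has_derivative D (rep c) q) (at q)"
  by (rule smooth_on_has_derivative[OF rep_smooth])

lemma rep_D_transition:
  assumes c: "c \<in> A" "q \<in> patch c" and d: "d \<in> A" "q \<in> patch d"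
  shows "D (rep d) q v = D (transition c d) (rep c q) (D (rep c) q v)"
proof -
  have "D (rep d) q = D (\<lambda>p. transition c d (rep c p)) q"
    using c d by (intro D_cong_open[of "patch c \<inter> patch d"] open_Int patch_open)
      (simp_all add: rep_transition del: o_apply)
  also have "\<dots> = (\<lambda>v. D (transition c d) (rep c q) (D (rep c) q v))"
    by (rule D_eqI[OF has_derivative_compose[OF rep_derivative[OF c]
          smooth_on_has_derivative[OF transition_smooth[OF c(1) d(1)] rep_overlap[OF c(2) d(2)]]]])
  finally show ?thesis by (rule fun_cong)
qed

text \<open>Tensor components in the coordinates \<open>x, y, r\<close> are computed in a chart; independence of the chart
  makes them smooth functions on all of \<open>V\<close>.\<close>

lemma glue:
  fixes g :: "'a chart \<Rightarrow> real^3 \<Rightarrow> real"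
  assumes sm: "\<And>c. c \<in> A \<Longrightarrow> smooth_on (patch c) (g c)"
    and eq: "\<And>c d q. c \<in> A \<Longrightarrow> d \<in> A \<Longrightarrow> q \<in> patch c \<Longrightarrow> q \<in> patch d \<Longrightarrow> g c q = g d q"
  shows "\<exists>G. smooth_on V G \<and> (\<forall>c q. c \<in> A \<longrightarrow> q \<in> patch c \<longrightarrow> G q = g c q)"
proof -
  define G where "G q = g (SOME c. c \<in> A \<and> q \<in> patch c) q" for q
  have G: "G q = g c q" if c: "c \<in> A" "q \<in> patch c" for c q
  proof -
    have "(SOME c. c \<in> A \<and> q \<in> patch c) \<in> A \<and> q \<in> patch (SOME c. c \<in> A \<and> q \<in> patch c)"
      by (rule someI[of "\<lambda>c. c \<in> A \<and> q \<in> patch c" c]) (use c in simp)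
    then show ?thesis unfolding G_def using eq c by blast
  qed
  have "smooth_on V G"
  proof (rule smooth_on_local)
    fix q assume "q \<in> V"
    then obtain c where c: "c \<in> A" "q \<in> patch c" by (rule patch_cover)
    have "smooth_on (patch c) G"
      by (rule smooth_on_cong[OF patch_open[OF c(1)] _ sm[OF c(1)]]) (rule G[OF c(1), symmetric])
    then show "\<exists>T. open T \<and> q \<in> T \<and> smooth_on T G" using patch_open[OF c(1)] c(2) by blast
  qed
  with G show ?thesis by (intro exI[of _ G] conjI allI impI)
qed

lemma F_periodic:
  assumes "q \<in> slab {a..b}"
  shows "F (q + E1) = F q" "F (q + E2) = F q"
proof -
  have "q \<in> slab I" "q + E1 \<in> slab I" "q + E2 \<in> slab I"
    using assms slab_ab(1) by (auto simp: slab_def axis_def)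
  then show "F (q + E1) = F q" "F (q + E2) = F q" by (simp_all add: F_eq axis_def)
qed

text \<open>Tensor components involve \<open>F\<close> and its first derivative. Translation invariance of the derivative
  in direction \<open>r\<close> at the boundary tori comes from one-sided differentiation, since the extension of
  \<open>F\<close> beyond the slab is arbitrary.\<close>

lemma rep_periodic:
  assumes c: "c \<in> A" and q: "q \<in> slab {a..b}" "q \<in> patch c" and E: "E = E1 \<or> E = E2"
  shows "q + E \<in> patch c" "rep c (q + E) = rep c q" "D (rep c) (q + E) = D (rep c) q"
proof -
  have FE: "F (p + E) = F p" if "p \<in> slab {a..b}" for p using F_periodic[OF that] E by auto
  have "q + E \<in> slab {a..b}" using q(1) E by (auto simp: slab_def axis_def)
  then show patch: "q + E \<in> patch c" using q(2) FE[OF q(1)] slab_ab(2) by (auto simp: patch_def)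
  show "rep c (q + E) = rep c q" using FE[OF q(1)] by simp
  have "((\<lambda>p. rep c (p + E)) has_derivative D (rep c) (q + E)) (at q)"
  proof -
    have "((\<lambda>p. p + E) has_derivative (\<lambda>v. v)) (at q)" by (auto intro!: derivative_eq_intros)
    from has_derivative_compose[OF this rep_derivative[OF c patch]] show ?thesis .
  qed
  then show "D (rep c) (q + E) = D (rep c) q"
    by (rule slab_derivative_unique[OF ab(1) q(1) open_UNIV UNIV_I _ rep_derivative[OF c q(2)]])
      (simp add: FE)
qed

lemma glued_periodic:
  fixes h :: "'a chart \<Rightarrow> real^3 \<Rightarrow> (real^3 \<Rightarrow> real^3) \<Rightarrow> real"
  assumes G: "\<And>c q. c \<in> A \<Longrightarrow> q \<in> patch c \<Longrightarrow> G q = h c (rep c q) (D (rep c) q)"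
  shows "slab_periodic a b G"
proof -
  have "G (q + E) = G q" if q: "q \<in> slab {a..b}" and E: "E = E1 \<or> E = E2" for q E
  proof -
    have "q \<in> V" using q slab_ab(2) by blast
    then obtain c where c: "c \<in> A" "q \<in> patch c" by (rule patch_cover)
    note * = rep_periodic[OF c(1) q c(2) E]
    show ?thesis unfolding G[OF c] G[OF c(1) *(1)] *(2,3) by (rule refl)
  qed
  then show ?thesis by (simp add: slab_periodic_def)
qed

lemma pull_vec_rep:
  assumes X: "vector_field A X" and q: "q \<in> slab I" and c: "c \<in> A" "q \<in> patch c"
  shows "D (rep c) q (pull_vec A F X q) = X c (rep c q)"
proof -
  have lin: "linear (D (rep c) q)" using rep_derivative[OF c] by (rule has_derivative_linear)
  have "det (matrix (D (rep c) q)) \<noteq> 0" using F_det[OF q c(1)] c(2) by (auto simp: patch_def)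
  then have inj: "inj (D (rep c) q)" using det_nz_iff_inj[OF lin] by blast
  then have "surj (D (rep c) q)" using linear_injective_imp_surjective[OF lin] by blast
  then obtain v where v: "D (rep c) q v = X c (rep c q)" by (metis surjD)
  have "pull_vec A F X q = v"
    unfolding pull_vec_def
  proof (rule the_equality)
    show "\<forall>d\<in>A. F q \<in> fst d \<longrightarrow> D (rep d) q v = X d (snd d (F q))"
    proof (intro ballI impI)
      fix d assume d: "d \<in> A" "F q \<in> fst d"
      then have dq: "q \<in> patch d" using c(2) by (simp add: patch_def)
      have "D (rep d) q v = D (transition c d) (rep c q) (X c (rep c q))"
        unfolding rep_D_transition[OF c d(1) dq] v by (rule refl)
      also have "\<dots> = X d (transition c d (rep c q))"
        by (rule vector_field_transition[OF X c(1) d(1) rep_overlap[OF c(2) dq], symmetric])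
      also have "\<dots> = X d (rep d q)" unfolding rep_transition[OF c] by (rule refl)
      finally show "D (rep d) q v = X d (snd d (F q))" by simp
    qed
    fix w assume "\<forall>d\<in>A. F q \<in> fst d \<longrightarrow> D (rep d) q w = X d (snd d (F q))"
    then have "D (rep c) q w = D (rep c) q v" using c v by (auto simp: patch_def)
    then show "w = v" using inj by (simp add: inj_eq)
  qed
  then show ?thesis using v by simp
qed

lemma pulled_three_form:
  assumes \<omega>: "three_form A \<omega>" and c: "c \<in> A" "q \<in> patch c" and d: "d \<in> A" "q \<in> patch d"
  shows "\<omega> c (rep c q) (D (rep c) q u) (D (rep c) q v) (D (rep c) q w)
    = \<omega> d (rep d q) (D (rep d) q u) (D (rep d) q v) (D (rep d) q w)"
  unfolding rep_D_transition[OF c d] rep_transition[OF c, of d, symmetric]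
  by (rule three_form_transition[OF \<omega> c(1) d(1) rep_overlap[OF c(2) d(2)]])

lemma pull_form3_rep:
  assumes \<omega>: "three_form A \<omega>" and c: "c \<in> A" "q \<in> patch c"
  shows "pull_form3 A F \<omega> q u v w = \<omega> c (rep c q) (D (rep c) q u) (D (rep c) q v) (D (rep c) q w)"
  unfolding pull_form3_def
proof (rule the_equality)
  show "\<forall>d\<in>A. F q \<in> fst d \<longrightarrow> \<omega> c (rep c q) (D (rep c) q u) (D (rep c) q v) (D (rep c) q w)
      = \<omega> d (snd d (F q)) (D (rep d) q u) (D (rep d) q v) (D (rep d) q w)"
  proof (intro ballI impI)
    fix d assume d: "d \<in> A" "F q \<in> fst d"
    then have "q \<in> patch d" using c(2) by (simp add: patch_def)
    from pulled_three_form[OF \<omega> c d(1) this]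
    show "\<omega> c (rep c q) (D (rep c) q u) (D (rep c) q v) (D (rep c) q w)
      = \<omega> d (snd d (F q)) (D (rep d) q u) (D (rep d) q v) (D (rep d) q w)" by simp
  qed
  fix t assume "\<forall>d\<in>A. F q \<in> fst d \<longrightarrow>
      t = \<omega> d (snd d (F q)) (D (rep d) q u) (D (rep d) q v) (D (rep d) q w)"
  then show "t = \<omega> c (rep c q) (D (rep c) q u) (D (rep c) q v) (D (rep c) q w)"
    using c by (auto simp: patch_def)
qed

end

section \<open>The direction of half twists\<close>

context torus_region
begin

text \<open>The coordinate expressions of \<open>\<alpha>\<close> (the functions \<open>P\<close>) and of the slope form (the functions
  \<open>B\<close>) satisfy the hypotheses of \<open>half_twist_direction\<close>. At each point these hypotheses are linear
  algebra in the frame \<open>L E1, L E2, L E3\<close> given by the derivative of the coordinates, with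
  \<open>X = x1 L E1 + x2 L E2\<close> in the kernel of \<open>d\<alpha>\<close>.\<close>

lemma half_twist_sign:
  assumes conn: "connected_space M"
    and X: "vector_field A X" "nonvanishing A X"
    and vol: "volume_form A \<mu>" "preserves A X \<mu>"
    and tangent: "\<And>q. q \<in> slab I \<Longrightarrow> pull_vec A F X q $ 3 = 0"
    and \<alpha>: "one_form A \<alpha>"
    and reeb: "\<And>c x. c \<in> A \<Longrightarrow> x \<in> chart_image c \<Longrightarrow> \<alpha> c x (X c x) > 0"
      "\<And>c x v. c \<in> A \<Longrightarrow> x \<in> chart_image c \<Longrightarrow> ext_deriv \<alpha> c x (X c x) v = 0"
    and \<epsilon>: "\<And>c x. c \<in> A \<Longrightarrow> x \<in> chart_image c \<Longrightarrow> \<epsilon> * wedge \<alpha> (ext_deriv \<alpha>) c x E1 E2 E3 > 0"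
    and opp: "slope A X \<mu> F b = - slope A X \<mu> F a"
  shows "\<exists>r\<in>{a<..<b}. \<epsilon> * Im (cnj (slope A X \<mu> F r) * slope A X \<mu> F a) > 0"
proof -
  have \<mu>: "three_form A \<mu>" using vol(1) by (simp add: volume_form_def)
  obtain s where s: "\<And>c x. c \<in> A \<Longrightarrow> x \<in> chart_image c \<Longrightarrow> s * \<mu> c x E1 E2 E3 > 0"
    using volume_form_sign[OF conn vol(1)] by blast
  define n where "n c = (\<lambda>y. \<mu> c y E1 E2 E3 *\<^sub>R X c y)" for c
  note n = divergence_free[OF X(1) \<mu> vol(2) _ chart_image_open, folded n_def]
  have alt: "alternating3 (\<mu> c y)" if "c \<in> A" "y \<in> chart_image c" for c y
    using \<mu> that by (auto simp: three_form_def)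

  have exP: "\<exists>G. smooth_on V G \<and> (\<forall>c q. c \<in> A \<longrightarrow> q \<in> patch c \<longrightarrow> G q = pullback1 (rep c) (\<alpha> c) q v)" for v
  proof -
    have "smooth_on (patch c) (\<lambda>q. pullback1 (rep c) (\<alpha> c) q v)" if c: "c \<in> A" for c
      using pullback1_smooth[OF patch_open[OF c] rep_smooth[OF c] chart_image_open[OF c] rep_image
          one_form_smooth_form[OF \<alpha> c]] by (simp add: smooth_form_def)
    moreover have "pullback1 (rep c) (\<alpha> c) q v = pullback1 (rep d) (\<alpha> d) q v"
      if "c \<in> A" "d \<in> A" "q \<in> patch c" "q \<in> patch d" for c d q
      unfolding pullback1_def rep_D_transition[OF that(1,3,2,4)] rep_transition[OF that(1,3), of d, symmetric]
      by (rule one_form_transition[OF \<alpha> that(1,2) rep_overlap[OF that(3,4)]])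
    ultimately show ?thesis by (rule glue)
  qed
  have "\<forall>v. \<exists>G. smooth_on V G \<and> (\<forall>c q. c \<in> A \<longrightarrow> q \<in> patch c \<longrightarrow> G q = pullback1 (rep c) (\<alpha> c) q v)"
    by (intro allI exP)
  from choice[OF this] obtain P where P: "\<And>v. smooth_on V (P v)"
    "\<And>v c q. c \<in> A \<Longrightarrow> q \<in> patch c \<Longrightarrow> P v q = pullback1 (rep c) (\<alpha> c) q v" by blast

  let ?\<beta> = "\<lambda>v c q. \<mu> c (rep c q) (D (rep c) q E3) (X c (rep c q)) (D (rep c) q v)"
  have \<beta>_flux: "?\<beta> v c q = flux (rep c) (n c) q v E3" if "c \<in> A" "q \<in> patch c" for v c q
  proof -
    have cyclic: "u \<bullet> cross3 x w = x \<bullet> cross3 w u" for u x w by (simp add: cross3_simps)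
    have "?\<beta> v c q = \<mu> c (rep c q) E1 E2 E3 * (D (rep c) q E3 \<bullet> cross3 (X c (rep c q)) (D (rep c) q v))"
      by (rule alternating3_det[OF alt[OF that(1) rep_in[OF that(2)]]])
    also have "\<dots> = flux (rep c) (n c) q v E3"
      unfolding flux_def n_def inner_scaleR_left cyclic[of "D (rep c) q E3"] by (rule refl)
    finally show ?thesis .
  qed
  have exB: "\<exists>G. smooth_on V G \<and> (\<forall>c q. c \<in> A \<longrightarrow> q \<in> patch c \<longrightarrow> G q = ?\<beta> v c q)" for v
  proof -
    have "smooth_on (patch c) (?\<beta> v c)" if c: "c \<in> A" for c
      by (rule smooth_on_cong[OF patch_open[OF c] \<beta>_flux[OF c, symmetric]
            flux_smooth[OF patch_open[OF c] rep_smooth[OF c] n(1)[OF c c] rep_image]])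
    moreover have "?\<beta> v c q = ?\<beta> v d q" if "c \<in> A" "d \<in> A" "q \<in> patch c" "q \<in> patch d" for c d q
    proof -
      have "X d (transition c d (rep c q)) = D (transition c d) (rep c q) (X c (rep c q))"
        by (rule vector_field_transition[OF X(1) that(1,2) rep_overlap[OF that(3,4)]])
      then show ?thesis
        unfolding rep_D_transition[OF that(1,3,2,4)] rep_transition[OF that(1,3), of d, symmetric]
        by (simp only:) (rule three_form_transition[OF \<mu> that(1,2) rep_overlap[OF that(3,4)]])
    qed
    ultimately show ?thesis by (rule glue)
  qed
  have "\<forall>v. \<exists>G. smooth_on V G \<and> (\<forall>c q. c \<in> A \<longrightarrow> q \<in> patch c \<longrightarrow> G q = ?\<beta> v c q)"
    by (intro allI exB)
  from choice[OF this] obtain B where B: "\<And>v. smooth_on V (B v)"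
    "\<And>v c q. c \<in> A \<Longrightarrow> q \<in> patch c \<Longrightarrow> B v q = ?\<beta> v c q" by blast

  have perP: "slab_periodic a b (P v)" for v
    by (rule glued_periodic[of _ "\<lambda>c y L. \<alpha> c y (L v)"]) (simp only: P(2) pullback1_def)
  have perB: "slab_periodic a b (B v)" for v
    by (rule glued_periodic[of _ "\<lambda>c y L. \<mu> c y (L E3) (X c y) (L v)"]) (simp only: B(2))

  have X_tangent: "\<exists>x1 x2. X c (rep c q) = x1 *\<^sub>R D (rep c) q E1 + x2 *\<^sub>R D (rep c) q E2"
    if q: "q \<in> slab {a..b}" and c: "c \<in> A" "q \<in> patch c" for c q
  proof -
    let ?L = "D (rep c) q" and ?x = "pull_vec A F X q"
    have lin: "linear ?L" using rep_derivative[OF c] by (rule has_derivative_linear)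
    have qI: "q \<in> slab I" using q slab_ab(1) by blast
    have "?L ?x = ?x $ 1 *\<^sub>R ?L E1 + ?x $ 2 *\<^sub>R ?L E2 + ?x $ 3 *\<^sub>R ?L E3"
      using arg_cong[OF expand3[of ?x], of ?L] by (simp only: linear_add[OF lin] linear_scale[OF lin])
    then show ?thesis
      unfolding pull_vec_rep[OF X(1) qI c] tangent[OF qI] by auto
  qed

  have pointwise: "D (P E1) q E2 = D (P E2) q E1 \<and> D (B E1) q E2 = D (B E2) q E1 \<and>
      s * (P E1 q * B E2 q - P E2 q * B E1 q) > 0 \<and>
      (D (P E3) q E1 - D (P E1) q E3) * B E2 q - (D (P E3) q E2 - D (P E2) q E3) * B E1 q = 0 \<and>
      \<epsilon> * (P E1 q * (D (P E3) q E2 - D (P E2) q E3) - P E2 q * (D (P E3) q E1 - D (P E1) q E3)) > 0"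
    if q: "q \<in> slab {a..b}" for q
  proof -
    have "q \<in> V" using q slab_ab(2) by blast
    then obtain c where c: "c \<in> A" "q \<in> patch c" by (rule patch_cover)
    define L where "L = D (rep c) q"
    define y where "y = rep c q"
    have y: "y \<in> chart_image c" unfolding y_def by (rule rep_in[OF c(2)])
    obtain x1 x2 where x: "X c y = x1 *\<^sub>R L E1 + x2 *\<^sub>R L E2"
      using X_tangent[OF q c] unfolding y_def L_def by blast
    have "X c y \<noteq> 0" using X(2) c(1) y unfolding nonvanishing_def by blast
    then have x_nz: "x1 \<noteq> 0 \<or> x2 \<noteq> 0" unfolding x by auto
    define m where "m = \<mu> c y E1 E2 E3"
    define \<delta> where "\<delta> = L E1 \<bullet> cross3 (L E2) (L E3)"
    have sm: "s * m > 0" unfolding m_def by (rule s[OF c(1) y])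
    have \<delta>: "\<delta> > 0"
      using F_det[of q c] q c slab_ab(1) unfolding \<delta>_def L_def det_matrix_eq_triple[symmetric] patch_def by blast
    \<comment> \<open>\<open>d\<alpha>\<close> in the coordinates \<open>x, y, r\<close>\<close>
    define w where "w u v = d1 (\<alpha> c) y (L u) (L v)" for u v
    have Pq: "P v q = \<alpha> c y (L v)" for v
      unfolding P(2)[OF c] pullback1_def L_def y_def by (rule refl)
    have DP: "D (P v) q u - D (P u) q v = w u v" for u v
    proof -
      have "D (P v) q = D (\<lambda>q. pullback1 (rep c) (\<alpha> c) q v) q" for v
        by (rule D_cong_open[OF patch_open[OF c(1)] c(2)]) (rule P(2)[OF c(1)])
      then have "D (P v) q u - D (P u) q v = d1 (pullback1 (rep c) (\<alpha> c)) q u v"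
        unfolding d1_def by (simp only:)
      also have "\<dots> = w u v"
        unfolding w_def L_def y_def
        by (rule d1_pullback1[OF patch_open[OF c(1)] rep_smooth[OF c(1)] chart_image_open[OF c(1)]
              rep_image one_form_smooth_form[OF \<alpha> c(1)] c(2)])
      finally show ?thesis .
    qed
    note lin = d1_bilinear[OF chart_image_open[OF c(1)] one_form_smooth_form[OF \<alpha> c(1)] y]
    have skew: "w u v = - w v u" for u v unfolding w_def by (rule d1_skew)
    have w0: "w u u = 0" for u using skew[of u u] by simp
    have kernel: "x1 * w E1 v + x2 * w E2 v = 0" for v
      using reeb(2)[OF c(1) y, of "L v"]
      unfolding ext_deriv_eq_d1 x linear_add[OF lin(1)] linear_scale[OF lin(1)] w_def by simp
    have w12: "w E1 E2 = 0"
      using kernel[of E1] kernel[of E2] w0 skew[of E2 E1] x_nz by auto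
    have tripleB: "B v q = m * (L E3 \<bullet> cross3 (X c y) (L v))" for v
      unfolding B(2)[OF c] y_def[symmetric] L_def[symmetric] m_def by (rule alternating3_det[OF alt[OF c(1) y]])
    have B1: "B E1 q = - x2 * (m * \<delta>)" and B2: "B E2 q = x1 * (m * \<delta>)"
      unfolding tripleB x \<delta>_def by (simp_all add: cross3_simps)
    have lin\<alpha>: "linear (\<alpha> c y)" using \<alpha> c(1) y by (auto simp: one_form_def)
    have \<alpha>X: "x1 * P E1 q + x2 * P E2 q > 0"
      using reeb(1)[OF c(1) y] unfolding x linear_add[OF lin\<alpha>] linear_scale[OF lin\<alpha>] Pq by simp
    have "s * (P E1 q * B E2 q - P E2 q * B E1 q) = (s * m) * \<delta> * (x1 * P E1 q + x2 * P E2 q)"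
      unfolding B1 B2 by (simp add: algebra_simps)
    also have "\<dots> > 0" using sm \<delta> \<alpha>X by simp
    finally have pos: "s * (P E1 q * B E2 q - P E2 q * B E1 q) > 0" .
    have "w E1 E3 * B E2 q - w E2 E3 * B E1 q = m * \<delta> * (x1 * w E1 E3 + x2 * w E2 E3)"
      unfolding B1 B2 by (simp add: algebra_simps)
    then have par: "w E1 E3 * B E2 q - w E2 E3 * B E1 q = 0" using kernel[of E3] by simp
    have "P E1 q * w E2 E3 - P E2 q * w E1 E3 = wedge \<alpha> (ext_deriv \<alpha>) c y (L E1) (L E2) (L E3)"
      unfolding wedge_def ext_deriv_eq_d1 Pq[symmetric] w_def[symmetric] using w12 skew[of E3 E1] by simp
    also have "\<dots> = wedge \<alpha> (ext_deriv \<alpha>) c y E1 E2 E3 * \<delta>"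
      unfolding \<delta>_def by (rule alternating3_det[OF wedge_alternating[OF \<alpha> c(1) y]])
    finally have "\<epsilon> * (P E1 q * w E2 E3 - P E2 q * w E1 E3) = (\<epsilon> * wedge \<alpha> (ext_deriv \<alpha>) c y E1 E2 E3) * \<delta>"
      by (simp only: mult.assoc)
    also have "\<dots> > 0" using \<epsilon>[OF c(1) y] \<delta> by simp
    finally have cont: "\<epsilon> * (P E1 q * w E2 E3 - P E2 q * w E1 E3) > 0" .
    \<comment> \<open>Closedness of the slope form is the vanishing of the divergence of \<open>X\<close>; the component of the
      flux through the torus vanishes identically on the slab.\<close>
    have F12: "D (\<lambda>q. flux (rep c) (n c) q E1 E2) q = (\<lambda>v. 0)"
    proof (rule slab_derivative_unique[OF ab(1) q patch_open[OF c(1)] c(2) _ has_derivative_const])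
      note sm = flux_smooth[OF patch_open[OF c(1)] rep_smooth[OF c(1)] n(1)[OF c(1) c(1)] rep_image]
      show "((\<lambda>q. flux (rep c) (n c) q E1 E2) has_derivative D (\<lambda>q. flux (rep c) (n c) q E1 E2) q) (at q)"
        by (rule smooth_on_has_derivative[OF sm c(2)])
      fix p assume p: "p \<in> patch c" "p \<in> slab {a..b}"
      obtain z1 z2 where "X c (rep c p) = z1 *\<^sub>R D (rep c) p E1 + z2 *\<^sub>R D (rep c) p E2"
        using X_tangent[OF p(2) c(1) p(1)] by blast
      then show "flux (rep c) (n c) p E1 E2 = 0"
        unfolding flux_def n_def by (simp only: inner_scaleR_left inner_add_left dot_cross_self) simp
    qed
    have F23: "D (\<lambda>q. flux (rep c) (n c) q E2 E3) q = D (B E2) q"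
      by (rule D_cong_open[OF patch_open[OF c(1)] c(2)]) (simp only: B(2)[OF c(1)] \<beta>_flux[OF c(1)])
    have F31: "D (\<lambda>q. flux (rep c) (n c) q E3 E1) q = (\<lambda>v. - D (B E1) q v)"
    proof -
      have "D (\<lambda>q. flux (rep c) (n c) q E3 E1) q = D (\<lambda>q. - B E1 q) q"
      proof (rule D_cong_open[OF patch_open[OF c(1)] c(2)])
        show "flux (rep c) (n c) p E3 E1 = - B E1 p" if "p \<in> patch c" for p
          unfolding B(2)[OF c(1) that] \<beta>_flux[OF c(1) that] unfolding flux_def
          by (subst cross_skew) (simp only: inner_minus_right)
      qed
      also have "\<dots> = (\<lambda>v. - D (B E1) q v)"
        by (rule D_eqI[OF has_derivative_minus[OF smooth_on_has_derivative[OF B(1) \<open>q \<in> V\<close>]]])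
      finally show ?thesis .
    qed
    have "D (B E2) q E1 + - D (B E1) q E2 + 0 = 0"
      using flux_closed[OF patch_open[OF c(1)] rep_smooth[OF c(1)] n(1)[OF c(1) c(1)] rep_image c(2)
          n(2)[OF c(1) c(1) rep_in[OF c(2)]]] unfolding F12 F23 F31 .
    then have "D (B E1) q E2 = D (B E2) q E1" by simp
    moreover have "D (P E1) q E2 = D (P E2) q E1"
      using DP[where u = E1 and v = E2] w12 by simp
    ultimately show ?thesis
      using pos par cont unfolding DP by blast
  qed

  have slope: "slope A X \<mu> F r = sgn (Complex (mean (\<lambda>z. B E1 (torus_pt z r))) (mean (\<lambda>z. B E2 (torus_pt z r))))"
    if r: "r \<in> {a..b}" for r
  proof -
    have "slope_form A F X \<mu> r z v = B E1 (torus_pt z r) * v $ 1 + B E2 (torus_pt z r) * v $ 2" for z v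
    proof -
      define q where "q = torus_pt z r"
      have q: "q \<in> slab {a..b}" using r by (simp add: q_def slab_def)
      then have "q \<in> V" "q \<in> slab I" using slab_ab by blast+
      then obtain c where c: "c \<in> A" "q \<in> patch c" using patch_cover by blast
      let ?L = "D (rep c) q" and ?y = "rep c q"
      have lin: "linear ?L" using rep_derivative[OF c] by (rule has_derivative_linear)
      have lin\<mu>: "linear (\<mu> c ?y u v)" for u v
        using alt[OF c(1) rep_in[OF c(2)]] by (simp add: alternating3_def)
      have "torus_vec (torus_field A F X r z) = pull_vec A F X q"
        using tangent[OF \<open>q \<in> slab I\<close>] unfolding torus_field_def Let_def q_def[symmetric]
        by (simp add: vec_eq_iff forall_3)
      then have "slope_form A F X \<mu> r z v = pull_form3 A F \<mu> q E3 (pull_vec A F X q) (torus_vec v)"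
        unfolding slope_form_def area_form_def q_def[symmetric] by (simp only:)
      also have "\<dots> = \<mu> c ?y (?L E3) (X c ?y) (?L (torus_vec v))"
        unfolding pull_form3_rep[OF \<mu> c] pull_vec_rep[OF X(1) \<open>q \<in> slab I\<close> c] by (rule refl)
      also have "\<dots> = v $ 1 * \<mu> c ?y (?L E3) (X c ?y) (?L E1) + v $ 2 * \<mu> c ?y (?L E3) (X c ?y) (?L E2)"
        unfolding torus_vec_eq linear_add[OF lin] linear_scale[OF lin] linear_add[OF lin\<mu>]
          linear_scale[OF lin\<mu>] by simp
      finally show ?thesis unfolding q_def[symmetric] B(2)[OF c] by (simp add: mult.commute)
    qed
    then have "slope_form A F X \<mu> r = (\<lambda>z v. B E1 (torus_pt z r) * v $ 1 + B E2 (torus_pt z r) * v $ 2)"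
      by blast
    moreover have "closed_torus_form (\<lambda>z. B E1 (torus_pt z r)) (\<lambda>z. B E2 (torus_pt z r))"
      using slice_closed_form[OF B(1) B(1) slab_ab(2) perB perB _ r] pointwise by blast
    ultimately show ?thesis
      unfolding slope_def by (simp only: torus_class_eq_means)
  qed

  show ?thesis
  proof (rule half_twist_direction[where P = "P E1" and Q = "P E2" and R = "P E3"
        and ?B1.0 = "B E1" and ?B2.0 = "B E2" and s = s and k = "slope A X \<mu> F"
        and ?\<gamma>1.0 = "\<lambda>q. D (P E3) q E1 - D (P E1) q E3" and ?\<gamma>2.0 = "\<lambda>q. D (P E3) q E2 - D (P E2) q E3"])
    show "slope A X \<mu> F r = sgn (Complex (mean (\<lambda>z. B E1 (torus_pt z r))) (mean (\<lambda>z. B E2 (torus_pt z r))))"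
      if "r \<in> {a..b}" for r by (rule slope[OF that])
  qed (use pointwise ab(1) V_open slab_ab(2) P(1) B(1) perP perB opp in blast)+
qed

end

text \<open>Moving clockwise from \<open>p\<close>, the point \<open>-p\<close> is reached at angle \<open>pi\<close>, so the arc consists of the
  points \<open>p * cis (-t)\<close> with \<open>0 < t < pi\<close>, and the quantity below is \<open>sin t\<close>.\<close>

lemma cw_arc_half_circle:
  assumes p: "cmod p = 1" and z: "z \<in> cw_arc p (- p)"
  shows "Im (cnj z * p) > 0"
proof -
  obtain t where t: "0 < t" "z = p * cis (- t)" "\<forall>s\<in>{0<..t}. p * cis (- s) \<noteq> - p"
    using z unfolding cw_arc_def by blast
  have "t < pi"
  proof (rule ccontr)
    assume "\<not> t < pi"
    then have "pi \<in> {0<..t}" by simp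
    moreover have "p * cis (- pi) = - p" by (simp add: complex_eq_iff)
    ultimately show False using t(3) by blast
  qed
  have "cnj z * p = (p * cnj p) * cis t" using t(2) by (simp add: cis_cnj)
  also have "\<dots> = cis t" using p by (simp add: complex_norm_square[symmetric])
  finally show ?thesis using sin_gt_zero[OF t(1) \<open>t < pi\<close>] by simp
qed

text \<open>Positive and negative twists differ only in the arc that contains the slopes, so the conclusion
  about an arbitrary kind \<open>tw\<close> of twist leaves only this arc to be examined.\<close>

lemma rational_half_twist_sign:
  assumes man: "oriented_3manifold M A" and conn: "connected_space M"
    and X: "vector_field A X" "nonvanishing A X"
    and twist: "admits_rational_half_twisting_region tw M A X"
    and opp: "\<And>k a b. tw k a b \<Longrightarrow> k b = - k a"
    and \<alpha>: "one_form A \<alpha>"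
    and reeb: "\<And>c x. c \<in> A \<Longrightarrow> x \<in> chart_image c \<Longrightarrow> \<alpha> c x (X c x) > 0"
      "\<And>c x v. c \<in> A \<Longrightarrow> x \<in> chart_image c \<Longrightarrow> ext_deriv \<alpha> c x (X c x) v = 0"
    and \<epsilon>: "\<And>c x. c \<in> A \<Longrightarrow> x \<in> chart_image c \<Longrightarrow> \<epsilon> * wedge \<alpha> (ext_deriv \<alpha>) c x E1 E2 E3 > 0"
  obtains k a b r where "tw k a b" "cmod (k a) = 1" "r \<in> {a<..<b}" "\<epsilon> * Im (cnj (k r) * k a) > 0"
proof -
  obtain \<mu> I F a b where \<mu>: "volume_form A \<mu>" "preserves A X \<mu>" and reg: "integrable_region M A X I F"
    and ab: "a < b" "{a..b} \<subseteq> I" and tw: "tw (slope A X \<mu> F) a b" "rational_point (slope A X \<mu> F a)"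
    using twist unfolding admits_rational_half_twisting_region_def by blast
  have tc: "oriented_torus_coords M A I F" and tan: "\<forall>q\<in>slab I. pull_vec A F X q $ 3 = 0"
    using reg by (auto simp: integrable_region_def)
  obtain V where V: "slab I \<subseteq> V" "smooth_into M A V F"
    using tc unfolding oriented_torus_coords_def by blast
  interpret torus_region M A I F V a b
    using man V ab tc unfolding oriented_torus_coords_def by unfold_locales blast+
  obtain r where "r \<in> {a<..<b}" "\<epsilon> * Im (cnj (slope A X \<mu> F r) * slope A X \<mu> F a) > 0"
    using half_twist_sign[OF conn X \<mu> _ \<alpha> reeb \<epsilon> opp[OF tw(1)]] tan by blast
  moreover have "cmod (slope A X \<mu> F a) = 1" using tw(2) by (simp add: rational_point_def)
  ultimately show thesis using that tw(1) by blast
qed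

theorem corollary20:
  fixes M :: "'a topology" and A :: "'a chart set" and X :: "'a vfield"
  assumes "oriented_3manifold M A" and "connected_space M"
    and "vector_field A X" and "nonvanishing A X" and "volume_preserving A X"
    and "admits_rational_half_twisting_region positive_half_twist M A X"
    and "admits_rational_half_twisting_region negative_half_twist M A X"
  shows "\<not> reeb_like A X"
proof
  assume "reeb_like A X"
  then obtain \<alpha> where ct: "contact_form A \<alpha>"
    and reeb: "\<And>c x. c \<in> A \<Longrightarrow> x \<in> chart_image c \<Longrightarrow> \<alpha> c x (X c x) > 0"
      "\<And>c x v. c \<in> A \<Longrightarrow> x \<in> chart_image c \<Longrightarrow> ext_deriv \<alpha> c x (X c x) v = 0"
    unfolding reeb_like_def by blast
  have \<alpha>: "one_form A \<alpha>" using ct by (simp add: contact_form_def)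
  interpret oriented_manifold M A by unfold_locales (rule assms(1))
  obtain \<epsilon> where \<epsilon>: "\<And>c x. c \<in> A \<Longrightarrow> x \<in> chart_image c \<Longrightarrow>
      \<epsilon> * wedge \<alpha> (ext_deriv \<alpha>) c x E1 E2 E3 > 0"
    using contact_form_sign[OF assms(2) ct] by blast
  note sign = rational_half_twist_sign[OF assms(1-4) _ _ \<alpha> reeb \<epsilon>]
  have "\<epsilon> > 0"
  proof -
    obtain k a b r where k: "positive_half_twist k a b" "cmod (k a) = 1" "r \<in> {a<..<b}"
      and pos: "\<epsilon> * Im (cnj (k r) * k a) > 0"
      by (rule sign[OF assms(6)]) (simp add: positive_half_twist_def)
    have "k r \<in> cw_arc (k a) (- k a)" using k(1,3) unfolding positive_half_twist_def by auto
    from cw_arc_half_circle[OF k(2) this] pos show ?thesis by (rule zero_less_mult_pos2[rotated])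
  qed
  moreover have "\<epsilon> < 0"
  proof -
    obtain k a b r where k: "negative_half_twist k a b" "cmod (k a) = 1" "r \<in> {a<..<b}"
      and pos: "\<epsilon> * Im (cnj (k r) * k a) > 0"
      by (rule sign[OF assms(7)]) (simp add: negative_half_twist_def)
    have "k r \<in> cw_arc (- k a) (- (- k a))" using k(1,3) unfolding negative_half_twist_def by auto
    from cw_arc_half_circle[OF _ this] k(2) have "Im (cnj (k r) * k a) < 0" by simp
    then show ?thesis using pos by (simp add: zero_less_mult_iff)
  qed
  ultimately show False by simp
qed

end
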